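(* Let $U$ be a unital complex associative algebra with multiplication map $m:U\otimes U\to U$, $\theta\in\mathrm{Aut}(U)$ an involutive unital algebra automorphism with $(\pm1)$-eigenspaces $U^{\pm}$, and $\mathfrak{a}\subseteq U^-$ a finite dimensional linear subspace. Let $r:\mathfrak{a}^*\to U^{\otimes 2}$ be a meromorphic function such that (i) $r$ is $\theta$-twisted symmetric: $\widetilde r:=(\theta\otimes\mathrm{id})r$ satisfies $\widetilde r_{21}=\widetilde r$; (ii) $r$ is $\mathfrak{a}$-invariant: $[x\otimes1+1\otimes x,r]=0$ for all $x\in\mathfrak{a}$; (iii) $r$ is a classical dynamical $r$-matrix: $\mathrm{YB}(r)=0$. Let $(r^+,r^-)$ be the associated classical dynamical $r$-matrix pair $r^{\pm}:=\frac12(\widetilde r\pm r)$. Then $\kappa^{\mathrm{core}}:=\frac12 m(\widetilde r):\mathfrak{a}^*\to U$ is a core classical dynamical $k$-matrix relative to $(r^+,r^-)$, i.e. $$\mathrm{CR}(r^+,r^-;\kappa^{\mathrm{core}})=0 .$$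
   Context: All tensor products are over $\mathbb{C}$. $\mathcal{M}$ is the field of meromorphic functions on $\mathfrak{a}^*$; for a complex algebra $B$, a meromorphic function $\mathfrak{a}^*\to B$ means an element of the algebraic tensor product $\mathcal{M}\otimes B$ (linear maps between such $B$'s are applied pointwise). If $z\in U^{\otimes k}$ and $i_1,\dots,i_k\in\{1,\dots,N\}$ are distinct, $z_{i_1\cdots i_k}\in U^{\otimes N}$ has the $j$-th tensor component of $z$ in position $i_j$ and $1$ elsewhere. Let $\{x_k\}_{k=1}^d$ be a basis of $\mathfrak{a}$ with dual basis $\{\lambda_k\}$ of $\mathfrak{a}^*$, $\partial_\lambda$ the directional derivative, and $E_i(f):=\sum_{k=1}^d (x_k)_i\,\partial_{\lambda_k}(f)$ for a $U^{\otimes N}$-valued meromorphic $f$. Definitions: $$\mathrm{YB}(r):=[r_{12},r_{13}]+[r_{12},r_{23}]+[r_{13},r_{23}]+E_1(r_{23})-E_2(r_{13})+E_3(r_{12}),$$ and for meromorphic $r^{\pm}:\mathfrak{a}^*\to U^{\otimes2}$ and $\kappa:\mathfrak{a}^*\to U$, $$\mathrm{CR}(r^+,r^-;\kappa):=[\kappa_1+r^-,\kappa_2+r^+]+E_2(r^-+\kappa_1)-E_1(r^++\kappa_2)$$ with values in $U^{\otimes 2}$, where $\kappa_1=\kappa\otimes1$, $\kappa_2=1\otimes\kappa$. ("Core" means that no auxiliary boundary algebras occur.) A pair $(r^+,r^-)$ of meromorphic functions $\mathfrak{a}^*\to U^{\otimes 2}$ is a classical dynamical $r$-matrix pair if $$[r_{12}^+,r_{13}^+]+[r_{12}^+,r_{23}^+]-[r_{13}^+,r_{23}^-]+E_3(r_{12}^+)-E_2(r_{13}^+)=0,$$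 $$[r_{12}^-,r_{13}^+]+[r_{12}^-,r_{23}^+]+[r_{13}^-,r_{23}^+]+E_3(r_{12}^-)-E_1(r_{23}^+)=0,$$ $$-[r_{12}^+,r_{13}^-]+[r_{12}^-,r_{23}^-]+[r_{13}^-,r_{23}^-]+E_2(r_{13}^-)-E_1(r_{23}^-)=0;$$ under (i) and (iii) the pair $r^{\pm}=\frac12(\widetilde r\pm r)$ has this property. *)

theory Defs
  imports "HOL-Complex_Analysis.Complex_Analysis" "HOL-Library.Poly_Mapping"
begin

section \<open>Complex vector spaces and unital complex algebras\<close>

class complex_vector = ab_group_add +
  fixes scaleC :: "complex \<Rightarrow> 'a \<Rightarrow> 'a"  (infixr \<open>*\<^sub>C\<close> 75)
  assumes scaleC_add_right: "c *\<^sub>C (x + y) = c *\<^sub>C x + c *\<^sub>C y"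
    and scaleC_add_left: "(c + d) *\<^sub>C x = c *\<^sub>C x + d *\<^sub>C x"
    and scaleC_scaleC: "c *\<^sub>C d *\<^sub>C x = (c * d) *\<^sub>C x"
    and scaleC_one: "1 *\<^sub>C x = x"

global_interpretation complex_vector: vector_space "scaleC :: complex \<Rightarrow> 'a \<Rightarrow> 'a::complex_vector"
  by unfold_locales (rule scaleC_add_right scaleC_add_left scaleC_scaleC scaleC_one)+

abbreviation clinear :: "('a::complex_vector \<Rightarrow> 'b::complex_vector) \<Rightarrow> bool"
  where "clinear \<equiv> Vector_Spaces.linear scaleC scaleC"

definition cbilinear :: "('a::complex_vector \<Rightarrow> 'b::complex_vector \<Rightarrow> 'c::complex_vector) \<Rightarrow> bool"
  where "cbilinear \<beta> \<longleftrightarrow> (\<forall>b. clinear (\<lambda>a. \<beta> a b)) \<and> (\<forall>a. clinear (\<beta> a))"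

lemma clinearI:
  fixes f :: "'a::complex_vector \<Rightarrow> 'b::complex_vector"
  assumes "\<And>x y. f (x + y) = f x + f y" "\<And>c x. f (c *\<^sub>C x) = c *\<^sub>C f x"
  shows "clinear f"
  using assms by unfold_locales auto

lemma clinear_simps:
  fixes f :: "'a::complex_vector \<Rightarrow> 'b::complex_vector"
  assumes "clinear f"
  shows "f (x + y) = f x + f y" "f (c *\<^sub>C x) = c *\<^sub>C f x" "f 0 = 0" "f (- x) = - f x"
    "f (x - y) = f x - f y"
proof -
  interpret Vector_Spaces.linear scaleC scaleC f by (fact assms)
  show "f (x + y) = f x + f y" "f (c *\<^sub>C x) = c *\<^sub>C f x" "f 0 = 0" "f (- x) = - f x"
    "f (x - y) = f x - f y"
    by (simp_all add: add scale zero neg diff)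
qed

instantiation complex :: complex_vector
begin

definition scaleC_complex :: "complex \<Rightarrow> complex \<Rightarrow> complex"
  where "scaleC_complex c z = c * z"

instance
  by intro_classes (simp_all add: scaleC_complex_def algebra_simps)

end

instantiation poly_mapping :: (type, complex_vector) complex_vector
begin

lift_definition scaleC_poly_mapping ::
    "complex \<Rightarrow> ('a \<Rightarrow>\<^sub>0 'b) \<Rightarrow> 'a \<Rightarrow>\<^sub>0 'b" is "\<lambda>c f k. c *\<^sub>C f k"
  by (erule rev_finite_subset) auto

instance
  by (intro_classes; transfer)
    (simp_all add: scaleC_add_right scaleC_add_left scaleC_scaleC scaleC_one)

end

text \<open>The library class \<^class>\<open>ring_1\<close> includes \<open>0 \<noteq> 1\<close>, which is not part of the
  definition of a unital algebra; hence the axioms are assembled from \<^class>\<open>ring\<close> and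
  \<^class>\<open>monoid_mult\<close>.\<close>

class complex_algebra_1 = complex_vector + ring + monoid_mult +
  assumes mult_scaleC_left: "(c *\<^sub>C x) * y = c *\<^sub>C (x * y)"
    and mult_scaleC_right: "x * (c *\<^sub>C y) = c *\<^sub>C (x * y)"

definition commutator :: "'a::ring \<Rightarrow> 'a \<Rightarrow> 'a"
  where "commutator a b = a * b - b * a"

definition algebra_automorphism :: "('a::complex_algebra_1 \<Rightarrow> 'a) \<Rightarrow> bool"
  where "algebra_automorphism \<theta> \<longleftrightarrow>
    clinear \<theta> \<and> bij \<theta> \<and> (\<forall>a b. \<theta> (a * b) = \<theta> a * \<theta> b) \<and> \<theta> 1 = 1"


section \<open>The algebraic tensor product over the complex numbers\<close>

abbreviation basis_pair :: "'a \<Rightarrow> 'b \<Rightarrow> ('a \<times> 'b) \<Rightarrow>\<^sub>0 complex"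
  where "basis_pair a b \<equiv> Poly_Mapping.single (a, b) 1"

definition tensor_relations :: "(('a::complex_vector \<times> 'b::complex_vector) \<Rightarrow>\<^sub>0 complex) set"
  where "tensor_relations =
    {basis_pair (a + a') b - basis_pair a b - basis_pair a' b | a a' b. True} \<union>
    {basis_pair a (b + b') - basis_pair a b - basis_pair a b' | a b b'. True} \<union>
    {basis_pair (c *\<^sub>C a) b - c *\<^sub>C basis_pair a b | c a b. True} \<union>
    {basis_pair a (c *\<^sub>C b) - c *\<^sub>C basis_pair a b | c a b. True}"

definition tensor_equiv :: "(('a::complex_vector \<times> 'b::complex_vector) \<Rightarrow>\<^sub>0 complex)
    \<Rightarrow> (('a \<times> 'b) \<Rightarrow>\<^sub>0 complex) \<Rightarrow> bool"
  where "tensor_equiv p q \<longleftrightarrow> p - q \<in> complex_vector.span tensor_relations"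

lemma equivp_tensor_equiv:
  "equivp (tensor_equiv :: (('a::complex_vector \<times> 'b::complex_vector) \<Rightarrow>\<^sub>0 complex) \<Rightarrow> _)"
  (is "equivp ?R")
proof (rule equivpI)
  show "reflp ?R"
    by (auto simp: reflp_def tensor_equiv_def complex_vector.span_zero)
  show "symp ?R"
    unfolding symp_def tensor_equiv_def using complex_vector.span_neg by fastforce
  show "transp ?R"
    unfolding transp_def tensor_equiv_def
  proof (intro allI impI)
    fix p q r :: "('a \<times> 'b) \<Rightarrow>\<^sub>0 complex"
    assume "p - q \<in> complex_vector.span tensor_relations" "q - r \<in> complex_vector.span tensor_relations"
    from complex_vector.span_add[OF this] show "p - r \<in> complex_vector.span tensor_relations"
      by simp
  qed
qed

quotient_type (overloaded) ('a, 'b) tensor (infixr \<open>\<otimes>\<close> 25) =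
  "('a::complex_vector \<times> 'b::complex_vector) \<Rightarrow>\<^sub>0 complex" / tensor_equiv
  by (rule equivp_tensor_equiv)

lift_definition pure_tensor :: "'a::complex_vector \<Rightarrow> 'b::complex_vector \<Rightarrow> 'a \<otimes> 'b"
  (infixr \<open>\<otimes>\<close> 75) is basis_pair .

instantiation tensor :: (complex_vector, complex_vector) complex_vector
begin

lift_definition zero_tensor :: "'a \<otimes> 'b" is 0 .

lift_definition plus_tensor :: "('a \<otimes> 'b) \<Rightarrow> ('a \<otimes> 'b) \<Rightarrow> ('a \<otimes> 'b)" is "(+)"
proof -
  fix p q p' q' :: "('a \<times> 'b) \<Rightarrow>\<^sub>0 complex"
  assume "tensor_equiv p q" "tensor_equiv p' q'"
  then show "tensor_equiv (p + p') (q + q')"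
    unfolding tensor_equiv_def add_diff_add by (rule complex_vector.span_add)
qed

lift_definition uminus_tensor :: "('a \<otimes> 'b) \<Rightarrow> ('a \<otimes> 'b)" is uminus
proof -
  fix p q :: "('a \<times> 'b) \<Rightarrow>\<^sub>0 complex"
  assume "tensor_equiv p q"
  then show "tensor_equiv (- p) (- q)"
    unfolding tensor_equiv_def minus_diff_minus by (rule complex_vector.span_neg)
qed

lift_definition minus_tensor :: "('a \<otimes> 'b) \<Rightarrow> ('a \<otimes> 'b) \<Rightarrow> ('a \<otimes> 'b)" is "(-)"
  proof -
  fix p q p' q' :: "('a \<times> 'b) \<Rightarrow>\<^sub>0 complex"
  have *: "(p - p') - (q - q') = (p - q) - (p' - q')" by (simp add: algebra_simps)
  assume "tensor_equiv p q" "tensor_equiv p' q'"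
  then show "tensor_equiv (p - p') (q - q')"
    unfolding tensor_equiv_def * by (rule complex_vector.span_diff)
qed

lift_definition scaleC_tensor :: "complex \<Rightarrow> ('a \<otimes> 'b) \<Rightarrow> ('a \<otimes> 'b)" is scaleC
proof -
  fix c and p q :: "('a \<times> 'b) \<Rightarrow>\<^sub>0 complex"
  assume "tensor_equiv p q"
  then show "tensor_equiv (c *\<^sub>C p) (c *\<^sub>C q)"
    unfolding tensor_equiv_def complex_vector.scale_right_diff_distrib[symmetric]
    by (rule complex_vector.span_scale)
qed

instance
proof
  fix x y z :: "'a \<otimes> 'b" and c d :: complex
  have refl: "tensor_equiv p p" for p :: "('a \<times> 'b) \<Rightarrow>\<^sub>0 complex"
    by (simp add: tensor_equiv_def complex_vector.span_zero)
  show "x + y + z = x + (y + z)"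
    by transfer (simp add: add.assoc refl)
  show "x + y = y + x"
    by transfer (simp add: add.commute refl)
  show "0 + x = x" "- x + x = 0" "x - y = x + - y"
    by (transfer, simp add: refl)+
  show "c *\<^sub>C (x + y) = c *\<^sub>C x + c *\<^sub>C y" "(c + d) *\<^sub>C x = c *\<^sub>C x + d *\<^sub>C x"
    "c *\<^sub>C d *\<^sub>C x = (c * d) *\<^sub>C x" "1 *\<^sub>C x = x"
    by (transfer, simp add: refl complex_vector.scale_right_distrib
        complex_vector.scale_left_distrib)+
qed

end

lemma pure_tensor_add_left: "(a + a') \<otimes> b = a \<otimes> b + a' \<otimes> b"
  by transfer (unfold tensor_equiv_def tensor_relations_def diff_diff_eq[symmetric],
      rule complex_vector.span_base, blast)

lemma pure_tensor_add_right: "a \<otimes> (b + b') = a \<otimes> b + a \<otimes> b'"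
  by transfer (unfold tensor_equiv_def tensor_relations_def diff_diff_eq[symmetric],
      rule complex_vector.span_base, blast)

lemma pure_tensor_scaleC_left: "(c *\<^sub>C a) \<otimes> b = c *\<^sub>C (a \<otimes> b)"
  by transfer (unfold tensor_equiv_def tensor_relations_def, rule complex_vector.span_base, blast)

lemma pure_tensor_scaleC_right: "a \<otimes> (c *\<^sub>C b) = c *\<^sub>C (a \<otimes> b)"
  by transfer (unfold tensor_equiv_def tensor_relations_def, rule complex_vector.span_base, blast)

lemma cbilinear_pure_tensor: "cbilinear (\<otimes>)"
  unfolding cbilinear_def
  by (auto intro!: clinearI simp: pure_tensor_add_left pure_tensor_add_right
      pure_tensor_scaleC_left pure_tensor_scaleC_right)

lemma tensor_induct [case_names pure add]:
  fixes t :: "'a::complex_vector \<otimes> 'b::complex_vector"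
  assumes pure: "\<And>a b. P (a \<otimes> b)" and add: "\<And>s t. P s \<Longrightarrow> P t \<Longrightarrow> P (s + t)"
  shows "P t"
proof -
  have monomial: "P (abs_tensor (Poly_Mapping.single k v))" for k v
  proof -
    have "Poly_Mapping.single k v = v *\<^sub>C basis_pair (fst k) (snd k)"
      by (rule poly_mapping_eqI)
        (auto simp: scaleC_poly_mapping.rep_eq lookup_single when_def scaleC_complex_def)
    then have "abs_tensor (Poly_Mapping.single k v) = (v *\<^sub>C fst k) \<otimes> snd k"
      unfolding pure_tensor_scaleC_left by (simp add: scaleC_tensor.abs_eq pure_tensor.abs_eq)
    then show ?thesis by (simp add: pure)
  qed
  have "P (abs_tensor p)" for p :: "('a \<times> 'b) \<Rightarrow>\<^sub>0 complex"
  proof (induction p rule: update_induct)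
    case const
    show ?case using monomial[of undefined 0] by simp
  next
    case (update p k v)
    have "Poly_Mapping.update k v p = p + Poly_Mapping.single k v"
      by (rule poly_mapping_eqI)
        (use update(1) in \<open>auto simp: lookup_update lookup_add lookup_single when_def in_keys_iff\<close>)
    then show ?case
      using add[OF update(3) monomial[of k v]] by (simp add: plus_tensor.abs_eq)
  qed
  then show ?thesis by (metis Quotient3_abs_rep Quotient3_tensor)
qed

definition formal_lift :: "('a \<Rightarrow> 'b \<Rightarrow> 'c::complex_vector) \<Rightarrow> (('a \<times> 'b) \<Rightarrow>\<^sub>0 complex) \<Rightarrow> 'c"
  where "formal_lift \<beta> p =
    (\<Sum>k\<in>Poly_Mapping.keys p. Poly_Mapping.lookup p k *\<^sub>C \<beta> (fst k) (snd k))"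

lemma formal_lift_superset:
  assumes "finite S" "Poly_Mapping.keys p \<subseteq> S"
  shows "formal_lift \<beta> p = (\<Sum>k\<in>S. Poly_Mapping.lookup p k *\<^sub>C \<beta> (fst k) (snd k))"
  unfolding formal_lift_def
  by (rule sum.mono_neutral_left) (use assms in \<open>auto simp: in_keys_iff\<close>)

lemma clinear_formal_lift: "clinear (formal_lift \<beta>)"
proof (rule clinearI)
  fix p q :: "('a \<times> 'b) \<Rightarrow>\<^sub>0 complex" and c :: complex
  let ?S = "Poly_Mapping.keys p \<union> Poly_Mapping.keys q"
  show "formal_lift \<beta> (p + q) = formal_lift \<beta> p + formal_lift \<beta> q"
    using formal_lift_superset[of ?S p \<beta>] formal_lift_superset[of ?S q \<beta>]
      formal_lift_superset[of ?S "p + q" \<beta>] keys_add[of p q]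
    by (simp add: lookup_add complex_vector.scale_left_distrib sum.distrib)
  have "Poly_Mapping.keys (c *\<^sub>C p) \<subseteq> Poly_Mapping.keys p"
    by (auto simp: in_keys_iff scaleC_poly_mapping.rep_eq)
  then show "formal_lift \<beta> (c *\<^sub>C p) = c *\<^sub>C formal_lift \<beta> p"
    using formal_lift_superset[of "Poly_Mapping.keys p" "c *\<^sub>C p" \<beta>]
    by (simp add: scaleC_poly_mapping.rep_eq scaleC_complex_def formal_lift_def
        complex_vector.scale_sum_right)
qed

lemma formal_lift_basis_pair [simp]: "formal_lift \<beta> (basis_pair a b) = \<beta> a b"
  by (simp add: formal_lift_def)

lemma formal_lift_relations:
  assumes \<beta>: "cbilinear \<beta>" and p: "p \<in> complex_vector.span tensor_relations"
  shows "formal_lift \<beta> p = 0"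
  using p
proof (induction rule: complex_vector.span_induct_alt)
  case base
  show ?case by (simp add: formal_lift_def)
next
  case (step c r q)
  note L = clinear_simps[OF clinear_formal_lift[of \<beta>]]
  have "\<beta> (a + a') b = \<beta> a b + \<beta> a' b" "\<beta> (c *\<^sub>C a) b = c *\<^sub>C \<beta> a b"
    "\<beta> a (b + b') = \<beta> a b + \<beta> a b'" "\<beta> a (c *\<^sub>C b) = c *\<^sub>C \<beta> a b" for a a' b b' c
    using \<beta> clinear_simps(1,2)[of "\<lambda>a. \<beta> a b"] clinear_simps(1,2)[of "\<beta> a"]
    unfolding cbilinear_def by auto
  then have "formal_lift \<beta> r = 0"
    using step.hyps(1) unfolding tensor_relations_def by (auto simp: L)
  then show ?case by (simp add: L step)
qed

text \<open>The linear map induced by a bilinear map (the value is meaningless for a map that is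
  not bilinear); see the lemma \<open>tensor_lift_pure\<close> below.\<close>

definition tensor_lift ::
    "('a::complex_vector \<Rightarrow> 'b::complex_vector \<Rightarrow> 'c::complex_vector) \<Rightarrow> ('a \<otimes> 'b) \<Rightarrow> 'c"
  where "tensor_lift \<beta> t = formal_lift \<beta> (rep_tensor t)"

lemma tensor_lift_abs:
  assumes "cbilinear \<beta>"
  shows "tensor_lift \<beta> (abs_tensor p) = formal_lift \<beta> p"
proof -
  have "tensor_equiv (rep_tensor (abs_tensor p)) p"
    by (metis Quotient3_tensor Quotient3_rep_abs tensor.abs_eq_iff Quotient3_abs_rep)
  then show ?thesis
    using formal_lift_relations[OF assms] clinear_simps(5)[OF clinear_formal_lift]
    unfolding tensor_equiv_def tensor_lift_def by (metis eq_iff_diff_eq_0)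
qed

lemma tensor_lift_pure [simp]:
  "cbilinear \<beta> \<Longrightarrow> tensor_lift \<beta> (a \<otimes> b) = \<beta> a b"
  by (simp add: pure_tensor.abs_eq tensor_lift_abs)

lemma clinear_tensor_lift: "cbilinear \<beta> \<Longrightarrow> clinear (tensor_lift \<beta>)"
proof (rule clinearI)
  fix s t :: "'a \<otimes> 'b" and c
  assume \<beta>: "cbilinear \<beta>"
  obtain p q where "s = abs_tensor p" "t = abs_tensor q"
    by (metis Quotient3_abs_rep Quotient3_tensor)
  then show "tensor_lift \<beta> (s + t) = tensor_lift \<beta> s + tensor_lift \<beta> t"
    and "tensor_lift \<beta> (c *\<^sub>C s) = c *\<^sub>C tensor_lift \<beta> s"
    by (simp_all add: plus_tensor.abs_eq scaleC_tensor.abs_eq tensor_lift_abs[OF \<beta>]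
        clinear_simps[OF clinear_formal_lift])
qed

lemma clinear_tensor_eqI:
  assumes "clinear f" "clinear g" "\<And>a b. f (a \<otimes> b) = g (a \<otimes> b)"
  shows "f t = g t"
  by (induction t rule: tensor_induct) (simp_all add: assms(3) clinear_simps(1)[OF assms(1)] clinear_simps(1)[OF assms(2)])

definition tensor_map :: "('a::complex_vector \<Rightarrow> 'c::complex_vector) \<Rightarrow>
    ('b::complex_vector \<Rightarrow> 'd::complex_vector) \<Rightarrow> ('a \<otimes> 'b) \<Rightarrow> ('c \<otimes> 'd)"
  where "tensor_map f g = tensor_lift (\<lambda>a b. f a \<otimes> g b)"

lemma cbilinear_tensor_map: "clinear f \<Longrightarrow> clinear g \<Longrightarrow> cbilinear (\<lambda>a b. f a \<otimes> g b)"
proof -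
  assume f: "clinear f" and g: "clinear g"
  show ?thesis
    unfolding cbilinear_def
    by (intro allI conjI clinearI)
      (simp_all only: clinear_simps(1,2)[OF f] clinear_simps(1,2)[OF g] pure_tensor_add_left
        pure_tensor_add_right pure_tensor_scaleC_left pure_tensor_scaleC_right)
qed

lemma tensor_map_pure [simp]:
  "clinear f \<Longrightarrow> clinear g \<Longrightarrow> tensor_map f g (a \<otimes> b) = f a \<otimes> g b"
  by (simp add: tensor_map_def cbilinear_tensor_map)

lemma clinear_tensor_map: "clinear f \<Longrightarrow> clinear g \<Longrightarrow> clinear (tensor_map f g)"
  by (simp add: tensor_map_def cbilinear_tensor_map clinear_tensor_lift)


subsection \<open>The tensor product of two unital algebras\<close>

definition tensor_mult :: "('a::complex_algebra_1 \<otimes> 'b::complex_algebra_1) \<Rightarrow> ('a \<otimes> 'b) \<Rightarrow> ('a \<otimes> 'b)"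
  where "tensor_mult s t = tensor_lift (\<lambda>a b. tensor_map ((*) a) ((*) b) t) s"

lemma clinear_mult_left: "clinear ((*) (a::'a::complex_algebra_1))"
  by (rule clinearI) (simp_all add: mult_scaleC_right distrib_left)

lemma cbilinear_tensor_map_mult:
  fixes t :: "'a::complex_algebra_1 \<otimes> 'b::complex_algebra_1"
  shows "cbilinear (\<lambda>(a::'a) (b::'b). tensor_map ((*) a) ((*) b) t)"
proof -
  have P: "tensor_map ((*) a) ((*) b) (a' \<otimes> b') = (a * a') \<otimes> (b * b')" for a a' :: 'a and b b' :: 'b
    by (simp add: clinear_mult_left)
  have L: "tensor_map ((*) a) ((*) b) (s + t) = tensor_map ((*) a) ((*) b) s + tensor_map ((*) a) ((*) b) t"
    for a :: 'a and b :: 'b and s t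
    by (rule clinear_simps(1)[OF clinear_tensor_map[OF clinear_mult_left clinear_mult_left]])
  show ?thesis
    unfolding cbilinear_def
  proof (intro allI conjI clinearI, goal_cases)
    case (1 b x y)
    show ?case
      by (induction t rule: tensor_induct) (simp_all only: P L, simp_all add: distrib_right pure_tensor_add_left)
  next
    case (2 b c x)
    show ?case
      by (induction t rule: tensor_induct)
        (simp_all only: P L, simp_all add: mult_scaleC_left pure_tensor_scaleC_left scaleC_add_right)
  next
    case (3 a x y)
    show ?case
      by (induction t rule: tensor_induct) (simp_all only: P L, simp_all add: distrib_right pure_tensor_add_right)
  next
    case (4 a c x)
    show ?case
      by (induction t rule: tensor_induct)
        (simp_all only: P L, simp_all add: mult_scaleC_left pure_tensor_scaleC_right scaleC_add_right)
  qed
qed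

lemma tensor_mult_pure_left: "tensor_mult (a \<otimes> b) t = tensor_map ((*) a) ((*) b) t"
  by (simp add: tensor_mult_def cbilinear_tensor_map_mult)

lemma tensor_mult_pure: "tensor_mult (a \<otimes> b) (a' \<otimes> b') = (a * a') \<otimes> (b * b')"
  by (simp add: tensor_mult_pure_left clinear_mult_left)

lemma cbilinear_tensor_mult: "cbilinear tensor_mult"
  unfolding cbilinear_def
proof (intro allI conjI)
  fix t :: "'a \<otimes> 'b"
  show left: "clinear (\<lambda>s. tensor_mult s t)" for t :: "'a \<otimes> 'b"
    unfolding tensor_mult_def by (rule clinear_tensor_lift[OF cbilinear_tensor_map_mult])
  fix s :: "'a \<otimes> 'b"
  show "clinear (tensor_mult s)"
  proof (rule clinearI)
    fix x y :: "'a \<otimes> 'b" and c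
    note inner = clinear_simps[OF clinear_tensor_map[OF clinear_mult_left clinear_mult_left]]
    show "tensor_mult s (x + y) = tensor_mult s x + tensor_mult s y"
      by (induction s rule: tensor_induct)
        (simp_all add: clinear_simps(1)[OF left] tensor_mult_pure_left inner)
    show "tensor_mult s (c *\<^sub>C x) = c *\<^sub>C tensor_mult s x"
      by (induction s rule: tensor_induct)
        (simp_all add: clinear_simps(1)[OF left] tensor_mult_pure_left inner scaleC_add_right)
  qed
qed

instantiation tensor :: (complex_algebra_1, complex_algebra_1) complex_algebra_1
begin

definition times_tensor :: "('a \<otimes> 'b) \<Rightarrow> ('a \<otimes> 'b) \<Rightarrow> ('a \<otimes> 'b)"
  where "times_tensor = tensor_mult"

definition one_tensor :: "'a \<otimes> 'b"
  where "one_tensor = 1 \<otimes> 1"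

instance
proof -
  have R: "clinear ((*) (s :: 'a \<otimes> 'b))" and L: "clinear (\<lambda>s. s * (t :: 'a \<otimes> 'b))" for s t
    using cbilinear_tensor_mult unfolding cbilinear_def times_tensor_def by blast+
  note R = clinear_simps[OF R] and L = clinear_simps[OF L]
  have P: "(a \<otimes> b) * (a' \<otimes> b') = (a * a') \<otimes> (b * b')" for a a' :: 'a and b b' :: 'b
    by (simp add: times_tensor_def tensor_mult_pure)
  show "OFCLASS('a \<otimes> 'b, complex_algebra_1_class)"
  proof
    fix s t u :: "'a \<otimes> 'b" and c
    show "(s + t) * u = s * u + t * u" "s * (t + u) = s * t + s * u"
      "(c *\<^sub>C s) * t = c *\<^sub>C (s * t)" "s * (c *\<^sub>C t) = c *\<^sub>C (s * t)"
      by (rule L R)+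
    show "s * t * u = s * (t * u)"
    proof (induction s rule: tensor_induct)
      case (pure a b)
      show ?case
      proof (induction t rule: tensor_induct)
        case (pure a' b')
        show ?case
          by (induction u rule: tensor_induct) (simp_all add: P R mult.assoc)
      qed (simp add: L R)
    qed (simp add: L)
    show "1 * s = s" "s * 1 = s"
      unfolding one_tensor_def by (induction s rule: tensor_induct) (simp_all add: P L R)
  qed
qed

end

lemma pure_tensor_mult: "(a \<otimes> b) * (a' \<otimes> b') = (a * a') \<otimes> (b * b')"
  by (simp add: times_tensor_def tensor_mult_pure)


section \<open>Meromorphic functions of several complex variables\<close>

class complex_normed_vector = complex_vector + real_normed_vector +
  assumes scaleR_scaleC: "scaleR a x = complex_of_real a *\<^sub>C x"
    and norm_scaleC: "norm (c *\<^sub>C x) = cmod c * norm x"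

instance complex :: complex_normed_vector
  by intro_classes (simp_all add: scaleC_complex_def scaleR_conv_of_real norm_mult)

instantiation vec :: (complex_normed_vector, finite) complex_normed_vector
begin

definition scaleC_vec :: "complex \<Rightarrow> ('a, 'b) vec \<Rightarrow> ('a, 'b) vec"
  where "scaleC_vec c x = (\<chi> i. c *\<^sub>C x $ i)"

instance
proof
  fix c d :: complex and x y :: "('a, 'b) vec" and a :: real
  show "c *\<^sub>C (x + y) = c *\<^sub>C x + c *\<^sub>C y" "(c + d) *\<^sub>C x = c *\<^sub>C x + d *\<^sub>C x"
    "c *\<^sub>C d *\<^sub>C x = (c * d) *\<^sub>C x" "1 *\<^sub>C x = x" "a *\<^sub>R x = complex_of_real a *\<^sub>C x"
    by (simp_all add: vec_eq_iff scaleC_vec_def scaleC_add_right scaleC_add_left scaleC_scaleC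
        scaleC_one scaleR_scaleC)
  show "norm (c *\<^sub>C x) = cmod c * norm x"
    by (simp add: norm_vec_def scaleC_vec_def norm_scaleC L2_set_right_distrib)
qed

end

definition holomorphic :: "('v::complex_normed_vector \<Rightarrow> complex) \<Rightarrow> 'v set \<Rightarrow> bool"
  where "holomorphic f S \<longleftrightarrow> (\<forall>x\<in>S. \<exists>D. (f has_derivative D) (at x) \<and> clinear D)"

definition directional_deriv :: "'v::complex_normed_vector \<Rightarrow> ('v \<Rightarrow> complex) \<Rightarrow> 'v \<Rightarrow> complex"
  where "directional_deriv v f x = deriv (\<lambda>\<zeta>. f (x + \<zeta> *\<^sub>C v)) 0"

lemma bounded_linear_scaleC_left: "bounded_linear (\<lambda>\<zeta>. \<zeta> *\<^sub>C (v::'v::complex_normed_vector))"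
proof (rule bounded_linear_intro[where K = "norm v"])
  show "(r *\<^sub>R x) *\<^sub>C v = r *\<^sub>R (x *\<^sub>C v)" for r x
    by (simp add: scaleR_scaleC scaleC_complex_def scaleC_scaleC)
qed (simp_all add: scaleC_add_left norm_scaleC)

lemma slice_has_field_derivative:
  fixes f :: "'v::complex_normed_vector \<Rightarrow> complex"
  assumes "(f has_derivative D) (at (x + \<zeta> *\<^sub>C v))" "clinear D"
  shows "((\<lambda>\<zeta>. f (x + \<zeta> *\<^sub>C v)) has_field_derivative D v) (at \<zeta>)"
proof -
  have "((\<lambda>\<zeta>. x + \<zeta> *\<^sub>C v) has_derivative (\<lambda>\<zeta>. \<zeta> *\<^sub>C v)) (at \<zeta>)"
    using has_derivative_add[OF has_derivative_const
        bounded_linear_imp_has_derivative[OF bounded_linear_scaleC_left[of v]], of x "at \<zeta>"]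
    by simp
  from has_derivative_compose[OF this assms(1)] show ?thesis
    unfolding has_field_derivative_def
    by (rule has_derivative_eq_rhs) (auto simp: clinear_simps[OF assms(2)] scaleC_complex_def)
qed

lemma directional_deriv_eq:
  assumes "(f has_derivative D) (at x)" "clinear D"
  shows "directional_deriv v f x = D v"
  unfolding directional_deriv_def using assms
  by (intro DERIV_imp_deriv slice_has_field_derivative) simp_all

lemma holomorphic_has_derivative:
  assumes "holomorphic f S" "x \<in> S"
  shows "(f has_derivative (\<lambda>v. directional_deriv v f x)) (at x)"
    and "clinear (\<lambda>v. directional_deriv v f x)"
proof -
  obtain D where D: "(f has_derivative D) (at x)" "clinear D"
    using assms unfolding holomorphic_def by blast
  then have "(\<lambda>v. directional_deriv v f x) = D" by (simp add: directional_deriv_eq fun_eq_iff)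
  then show "(f has_derivative (\<lambda>v. directional_deriv v f x)) (at x)"
    and "clinear (\<lambda>v. directional_deriv v f x)" using D by simp_all
qed

lemma holomorphic_subset: "holomorphic f S \<Longrightarrow> T \<subseteq> S \<Longrightarrow> holomorphic f T"
  unfolding holomorphic_def by blast

lemma holomorphic_continuous: "holomorphic f S \<Longrightarrow> x \<in> S \<Longrightarrow> isCont f x"
  using holomorphic_has_derivative(1) has_derivative_continuous by blast

lemma holomorphic_slice_deriv:
  assumes "holomorphic f S" "x + \<zeta> *\<^sub>C v \<in> S"
  shows "((\<lambda>\<zeta>. f (x + \<zeta> *\<^sub>C v)) has_field_derivative directional_deriv v f (x + \<zeta> *\<^sub>C v)) (at \<zeta>)"
  by (rule slice_has_field_derivative; rule holomorphic_has_derivative[OF assms])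

lemma holomorphic_const: "holomorphic (\<lambda>_. c) S"
  unfolding holomorphic_def
  by (auto intro!: exI[of _ "\<lambda>_. 0"] clinearI simp: scaleC_complex_def)

lemma holomorphic_add: "holomorphic f S \<Longrightarrow> holomorphic g S \<Longrightarrow> holomorphic (\<lambda>x. f x + g x) S"
  unfolding holomorphic_def
proof (intro ballI, goal_cases)
  case (1 x)
  then obtain D E where D: "(f has_derivative D) (at x)" "clinear D"
      and E: "(g has_derivative E) (at x)" "clinear E"
    by blast
  note [simp] = clinear_simps(1,2)[OF D(2)] clinear_simps(1,2)[OF E(2)]
  from D E show ?case
    by (intro exI[of _ "\<lambda>h. D h + E h"])
      (auto intro!: derivative_intros clinearI simp: scaleC_complex_def algebra_simps)
qed

lemma holomorphic_mult: "holomorphic f S \<Longrightarrow> holomorphic g S \<Longrightarrow> holomorphic (\<lambda>x. f x * g x) S"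
  unfolding holomorphic_def
proof (intro ballI, goal_cases)
  case (1 x)
  then obtain D E where D: "(f has_derivative D) (at x)" "clinear D"
      and E: "(g has_derivative E) (at x)" "clinear E"
    by blast
  note [simp] = clinear_simps(1,2)[OF D(2)] clinear_simps(1,2)[OF E(2)]
  from D E show ?case
    by (intro exI[of _ "\<lambda>h. f x * E h + D h * g x"] conjI has_derivative_mult clinearI)
      (simp_all add: scaleC_complex_def algebra_simps)
qed

lemma holomorphic_uminus: "holomorphic f S \<Longrightarrow> holomorphic (\<lambda>x. - f x) S"
  using holomorphic_mult[OF holomorphic_const[of "-1"]] by simp

lemma holomorphic_diff: "holomorphic f S \<Longrightarrow> holomorphic g S \<Longrightarrow> holomorphic (\<lambda>x. f x - g x) S"
  using holomorphic_add[OF _ holomorphic_uminus, of f S g] by simp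


subsection \<open>Directional derivatives of holomorphic functions are holomorphic\<close>

lemma slice_in_ball:
  fixes p v z :: "'v::complex_normed_vector"
  assumes "z \<in> ball p s" "cmod \<zeta> * norm v \<le> t"
  shows "z + \<zeta> *\<^sub>C v \<in> ball p (s + t)"
proof -
  have "norm (p - (z + \<zeta> *\<^sub>C v)) \<le> norm (p - z) + norm (\<zeta> *\<^sub>C v)"
    by (metis diff_diff_add norm_triangle_ineq4)
  then show ?thesis using assms by (simp add: dist_norm norm_scaleC)
qed

lemma directional_deriv_bound:
  fixes f :: "'v::complex_normed_vector \<Rightarrow> complex"
  assumes hol: "holomorphic f (ball p R)" and bound: "\<And>x. x \<in> ball p R \<Longrightarrow> cmod (f x) \<le> M"
    and "z \<in> ball p s" "s + t = R" "\<rho> * norm v < t" "\<rho> > 0"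
  shows "cmod (directional_deriv v f z) \<le> M / \<rho>"
proof -
  have in_ball: "z + \<zeta> *\<^sub>C v \<in> ball p R" if "cmod \<zeta> \<le> \<rho>" for \<zeta>
  proof -
    have "cmod \<zeta> * norm v \<le> t"
      using mult_right_mono[OF that norm_ge_zero, of v] assms by linarith
    then show ?thesis using slice_in_ball assms by blast
  qed
  have der: "((\<lambda>\<zeta>. f (z + \<zeta> *\<^sub>C v)) has_field_derivative directional_deriv v f (z + \<zeta> *\<^sub>C v)) (at \<zeta>)"
    if "cmod \<zeta> \<le> \<rho>" for \<zeta>
    using holomorphic_slice_deriv[OF hol in_ball[OF that]] .
  have "cmod ((deriv ^^ 1) (\<lambda>\<zeta>. f (z + \<zeta> *\<^sub>C v)) 0) \<le> fact 1 * M / \<rho> ^ 1"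
  proof (rule Cauchy_inequality)
    show "(\<lambda>\<zeta>. f (z + \<zeta> *\<^sub>C v)) holomorphic_on ball 0 \<rho>"
      using der holomorphic_on_open[of "ball 0 \<rho>"]
      by (metis less_imp_le mem_ball_0 open_ball)
    show "continuous_on (cball 0 \<rho>) (\<lambda>\<zeta>. f (z + \<zeta> *\<^sub>C v))"
      by (intro continuous_at_imp_continuous_on ballI DERIV_isCont[OF der]) auto
    show "cmod (f (z + x *\<^sub>C v)) \<le> M" if "cmod (0 - x) = \<rho>" for x
      using that by (intro bound in_ball) simp
  qed fact
  then show ?thesis by (simp add: directional_deriv_def)
qed

lemma holomorphic_taylor:
  fixes f :: "'v::complex_normed_vector \<Rightarrow> complex"
  assumes hol: "holomorphic f (ball p (3 * \<rho>))"
    and bound: "\<And>x. x \<in> ball p (3 * \<rho>) \<Longrightarrow> cmod (f x) \<le> M"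
    and z: "z \<in> ball p \<rho>" and h: "norm h < \<rho>"
  shows "cmod (f (z + h) - f z - directional_deriv h f z) \<le> 2 * M / \<rho>\<^sup>2 * (norm h)\<^sup>2"
proof (cases "h = 0")
  case True
  have "directional_deriv h f z = 0"
    unfolding directional_deriv_def by (simp add: True)
  then show ?thesis using True by simp
next
  case False
  have \<rho>: "\<rho> > 0" using z by (smt (verit) mem_ball zero_le_dist)
  define r where "r = \<rho> / norm h"
  have r: "r > 1" "r * norm h = \<rho>" using False h \<rho> by (auto simp: r_def field_simps)
  define \<phi> where "\<phi> = (\<lambda>\<zeta>. f (z + \<zeta> *\<^sub>C h))"
  have in_ball: "z + \<zeta> *\<^sub>C h \<in> ball p (3 * \<rho>)" if "cmod \<zeta> < 2 * r" for \<zeta>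
  proof -
    have "cmod \<zeta> * norm h \<le> 2 * \<rho>"
      using mult_right_mono[OF less_imp_le[OF that] norm_ge_zero, of h] r(2) by simp
    from slice_in_ball[OF z this] show ?thesis by simp
  qed
  have hol\<phi>: "\<phi> holomorphic_on ball 0 (2 * r)"
    unfolding \<phi>_def holomorphic_on_open[OF open_ball] mem_ball_0 Ball_def
    using holomorphic_slice_deriv[OF hol in_ball] by blast
  have bnd2: "cmod (deriv (deriv \<phi>) \<zeta>) \<le> 2 * M / r\<^sup>2" if "\<zeta> \<in> cball 0 1" for \<zeta>
  proof -
    have sub: "cball \<zeta> r \<subseteq> ball 0 (2 * r)"
    proof
      fix w assume "w \<in> cball \<zeta> r"
      then have "cmod w \<le> cmod \<zeta> + r"
        using norm_triangle_sub[of w \<zeta>] by (simp add: dist_norm norm_minus_commute)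
      then show "w \<in> ball 0 (2 * r)" using that r by simp
    qed
    have "cmod ((deriv ^^ 2) \<phi> \<zeta>) \<le> fact 2 * M / r ^ 2"
    proof (rule Cauchy_inequality)
      show "\<phi> holomorphic_on ball \<zeta> r"
        using hol\<phi> sub ball_subset_cball holomorphic_on_subset by blast
      show "continuous_on (cball \<zeta> r) \<phi>"
        using hol\<phi> sub holomorphic_on_subset holomorphic_on_imp_continuous_on by blast
      show "cmod (\<phi> x) \<le> M" if "cmod (\<zeta> - x) = r" for x
        unfolding \<phi>_def using that sub
        by (intro bound in_ball) (auto simp: subset_iff dist_norm)
    qed (use r in simp)
    then show ?thesis by (simp add: numeral_2_eq_2 fact_numeral)
  qed
  have o: "open (ball (0::complex) (2 * r))" and c1: "cball 0 1 \<subseteq> ball (0::complex) (2 * r)"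
    using r by auto
  have "cmod (\<phi> 1 - (\<Sum>i\<le>1. (deriv ^^ i) \<phi> 0 * (1 - 0) ^ i / fact i))
      \<le> 2 * M / r\<^sup>2 * cmod (1 - 0) ^ Suc 1 / fact 1"
  proof (rule complex_Taylor[where S = "cball 0 1" and f = "\<lambda>i. (deriv ^^ i) \<phi>", simplified funpow_0])
    show "((deriv ^^ i) \<phi> has_field_derivative (deriv ^^ Suc i) \<phi> x) (at x within cball 0 1)"
      if "x \<in> cball 0 1" for i x
      using holomorphic_derivI[OF holomorphic_higher_deriv[OF hol\<phi> o] o, of x i] that c1
      by (auto intro: DERIV_subset)
    show "cmod ((deriv ^^ Suc 1) \<phi> x) \<le> 2 * M / r\<^sup>2" if "x \<in> cball 0 1" for x
      using bnd2[OF that] by simp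
  qed auto
  moreover have "2 * M / r\<^sup>2 = 2 * M / \<rho>\<^sup>2 * (norm h)\<^sup>2"
    by (simp add: r_def power_divide)
  ultimately show ?thesis
    by (simp add: \<phi>_def directional_deriv_def scaleC_one diff_diff_eq)
qed

lemma holomorphic_directional_deriv:
  fixes f :: "'v::complex_normed_vector \<Rightarrow> complex"
  assumes hol: "holomorphic f S" and S: "open S"
  shows "holomorphic (directional_deriv v f) S"
  unfolding holomorphic_def
proof
  fix p assume p: "p \<in> S"
  obtain e1 where e1: "e1 > 0" "ball p e1 \<subseteq> S"
    using S p open_contains_ball by blast
  obtain e2 where e2: "e2 > 0" "\<And>x. dist p x < e2 \<Longrightarrow> dist (f p) (f x) < 1"
    using holomorphic_continuous[OF hol p] unfolding continuous_at_eps_delta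
    by (metis dist_commute zero_less_one)
  define \<rho> where "\<rho> = min e1 e2 / 3"
  define M where "M = cmod (f p) + 1"
  have \<rho>: "\<rho> > 0" "3 * \<rho> \<le> e1" "3 * \<rho> \<le> e2" using e1 e2 by (auto simp: \<rho>_def)
  have M: "M > 0" unfolding M_def by (smt (verit) norm_ge_zero)
  have holB: "holomorphic f (ball p (3 * \<rho>))"
    using hol e1(2) \<rho>(2) by (meson holomorphic_subset subset_ball subset_trans)
  have bound: "cmod (f x) \<le> M" if "x \<in> ball p (3 * \<rho>)" for x
  proof -
    have "dist (f p) (f x) < 1" using that \<rho> by (intro e2) auto
    then show ?thesis unfolding M_def dist_norm
      by (smt (verit) norm_triangle_ineq2 norm_minus_commute)
  qed
  note taylor = holomorphic_taylor[OF holB bound]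
  have small: "ball p \<rho> \<subseteq> ball p (3 * \<rho>)" using \<rho> by auto
  define D where "D h x = directional_deriv h f x" for h x
  define L where "L h = directional_deriv v (D h) p" for h
  define \<tau> where "\<tau> = \<rho> / (2 * (norm v + 1))"
  have \<tau>: "\<tau> > 0" "\<tau> * norm v < \<rho> / 2"
    using \<rho>(1) by (auto simp: \<tau>_def field_simps add_pos_nonneg)
  define B where "B = ball (0::complex) \<tau>"
  have B: "open B" "0 \<in> B" using \<tau> by (auto simp: B_def)
  have inB: "p + \<zeta> *\<^sub>C v \<in> ball p (\<rho> / 2)" if "\<zeta> \<in> B" for \<zeta>
  proof -
    have "cmod \<zeta> * norm v \<le> \<tau> * norm v"
      using that by (intro mult_right_mono) (auto simp: B_def)
    then show ?thesis using \<tau> by (simp add: dist_norm norm_scaleC)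
  qed
  have half: "ball p (\<rho> / 2) \<subseteq> ball p \<rho>" using \<rho> by auto
  have inB': "p + \<zeta> *\<^sub>C v + h \<in> ball p \<rho>" if "\<zeta> \<in> B" "norm h < \<rho> / 2" for \<zeta> h
  proof -
    have "dist p (p + \<zeta> *\<^sub>C v + h) \<le> dist p (p + \<zeta> *\<^sub>C v) + norm h"
      using dist_triangle[of p "p + \<zeta> *\<^sub>C v + h" "p + \<zeta> *\<^sub>C v"] by (simp add: dist_norm)
    then show ?thesis using inB[OF that(1)] that(2) by auto
  qed
  have D_lin: "clinear (\<lambda>h. D h x)" if "x \<in> ball p \<rho>" for x
    unfolding D_def using holomorphic_has_derivative(2)[OF holB] small that by blast
  have slice_hol: "(\<lambda>\<zeta>. f (p + \<zeta> *\<^sub>C v + h)) holomorphic_on B" if "norm h < \<rho> / 2" for h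
  proof -
    have "(\<lambda>\<zeta>. f (p + \<zeta> *\<^sub>C v + h)) = (\<lambda>\<zeta>. f ((p + h) + \<zeta> *\<^sub>C v))"
      by (simp add: algebra_simps)
    moreover have "(\<lambda>\<zeta>. f ((p + h) + \<zeta> *\<^sub>C v)) field_differentiable at \<zeta>" if "\<zeta> \<in> B" for \<zeta>
      using inB'[OF that \<open>norm h < \<rho> / 2\<close>] holomorphic_slice_deriv[OF holB, of "p + h" \<zeta> v] small
      unfolding field_differentiable_def by (force simp: algebra_simps)
    ultimately show ?thesis
      by (simp add: holomorphic_on_def field_differentiable_at_within)
  qed
  have D_hol: "(\<lambda>\<zeta>. D h (p + \<zeta> *\<^sub>C v)) holomorphic_on B" for h
  proof -
    define C where "C = 2 * M / \<rho>\<^sup>2 * (norm h)\<^sup>2"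
    obtain N :: nat where N: "real N > 2 * norm h / \<rho>" "N > 0"
    proof -
      obtain N :: nat where "real N > max 0 (2 * norm h / \<rho>)"
        using reals_Archimedean2 by blast
      then show ?thesis by (intro that[of N]) auto
    qed
    define h' where "h' n = complex_of_real (1 / real (n + N)) *\<^sub>C h" for n
    have h'_norm: "norm (h' n) = norm h / real (n + N)" for n
      unfolding h'_def norm_scaleC norm_of_real using N(2) by simp
    have h'_small: "norm (h' n) < \<rho> / 2" for n
    proof -
      have "norm h < \<rho> / 2 * real (n + N)"
      proof -
        have "norm h < \<rho> / 2 * real N" using N \<rho>(1) by (simp add: field_simps)
        also have "\<dots> \<le> \<rho> / 2 * real (n + N)" using \<rho>(1) by (intro mult_left_mono) auto
        finally show ?thesis .
      qed
      then show ?thesis using N(2) unfolding h'_norm by (subst pos_divide_less_eq) auto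
    qed
    let ?q = "\<lambda>n \<zeta>. of_nat (n + N) * (f (p + \<zeta> *\<^sub>C v + h' n) - f (p + \<zeta> *\<^sub>C v))"
    have est: "cmod (?q n \<zeta> - D h (p + \<zeta> *\<^sub>C v)) \<le> C / real (n + N)" if "\<zeta> \<in> B" for n \<zeta>
    proof -
      let ?z = "p + \<zeta> *\<^sub>C v"
      have z: "?z \<in> ball p \<rho>" using inB[OF that] half by blast
      have hh: "norm (h' n) < \<rho>" using h'_small[of n] \<rho>(1) by linarith
      have Dh: "D (h' n) ?z = D h ?z / of_nat (n + N)"
        unfolding h'_def clinear_simps(2)[OF D_lin[OF z]]
        by (simp add: scaleC_complex_def)
      have "?q n \<zeta> - D h ?z = of_nat (n + N) * (f (?z + h' n) - f ?z - D (h' n) ?z)"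
        unfolding Dh using N(2) by (simp add: right_diff_distrib del: of_nat_add)
      then have "cmod (?q n \<zeta> - D h ?z)
          = real (n + N) * cmod (f (?z + h' n) - f ?z - D (h' n) ?z)"
        by (simp add: norm_mult del: of_nat_add)
      also have "\<dots> \<le> real (n + N) * (2 * M / \<rho>\<^sup>2 * (norm (h' n))\<^sup>2)"
        using taylor[OF _ z hh] unfolding D_def by (intro mult_left_mono) auto
      also have "\<dots> = C / real (n + N)"
        unfolding h'_norm C_def using N(2) by (simp add: power_divide power2_eq_square)
      finally show ?thesis .
    qed
    have lim: "uniform_limit B ?q (\<lambda>\<zeta>. D h (p + \<zeta> *\<^sub>C v)) sequentially"
    proof (rule uniform_limitI)
      fix e :: real assume e: "e > 0"
      have "(\<lambda>n. C / real (n + N)) \<longlonglongrightarrow> 0"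
        using LIMSEQ_ignore_initial_segment[OF lim_const_over_n[of C], of N] by simp
      then have "\<forall>\<^sub>F n in sequentially. C / real (n + N) < e"
        using e by (rule order_tendstoD(2))
      then show "\<forall>\<^sub>F n in sequentially. \<forall>\<zeta>\<in>B. dist (?q n \<zeta>) (D h (p + \<zeta> *\<^sub>C v)) < e"
        by eventually_elim (use est in \<open>auto simp: dist_norm intro: le_less_trans\<close>)
    qed
    show ?thesis
    proof (rule holomorphic_uniform_sequence[OF B(1)])
      show "?q n holomorphic_on B" for n
        using slice_hol[OF h'_small[of n]] slice_hol[of 0] \<rho>(1)
        by (intro holomorphic_intros) auto
      show "\<exists>d>0. cball x d \<subseteq> B \<and> uniform_limit (cball x d) ?q (\<lambda>\<zeta>. D h (p + \<zeta> *\<^sub>C v)) sequentially"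
        if "x \<in> B" for x
        using open_contains_cball[of B] B(1) that lim uniform_limit_on_subset by blast
    qed
  qed
  have D_diff: "(\<lambda>\<zeta>. D h (p + \<zeta> *\<^sub>C v)) field_differentiable at 0" for h
    using D_hol[of h] B holomorphic_on_imp_differentiable_at by blast
  have L_lin: "clinear L"
  proof (rule clinearI)
    fix x y :: 'v and c
    have ev: "\<forall>\<^sub>F \<zeta> in nhds 0. \<zeta> \<in> B" using B by (simp add: eventually_nhds_in_open)
    have "L (x + y) = deriv (\<lambda>\<zeta>. D x (p + \<zeta> *\<^sub>C v) + D y (p + \<zeta> *\<^sub>C v)) 0"
      unfolding L_def directional_deriv_def
    proof (rule deriv_cong_ev[OF eventually_mono[OF ev]])
      fix \<zeta> assume "\<zeta> \<in> B"
      with inB half have "p + \<zeta> *\<^sub>C v \<in> ball p \<rho>" by blast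
      from clinear_simps(1)[OF D_lin[OF this]]
      show "D (x + y) (p + \<zeta> *\<^sub>C v) = D x (p + \<zeta> *\<^sub>C v) + D y (p + \<zeta> *\<^sub>C v)" .
    qed simp
    also have "\<dots> = L x + L y"
      unfolding L_def directional_deriv_def by (rule deriv_add[OF D_diff D_diff])
    finally show "L (x + y) = L x + L y" .
    have "L (c *\<^sub>C x) = deriv (\<lambda>\<zeta>. c * D x (p + \<zeta> *\<^sub>C v)) 0"
      unfolding L_def directional_deriv_def
    proof (rule deriv_cong_ev[OF eventually_mono[OF ev]])
      fix \<zeta> assume "\<zeta> \<in> B"
      with inB half have "p + \<zeta> *\<^sub>C v \<in> ball p \<rho>" by blast
      from clinear_simps(2)[OF D_lin[OF this]]
      show "D (c *\<^sub>C x) (p + \<zeta> *\<^sub>C v) = c * D x (p + \<zeta> *\<^sub>C v)"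
        by (simp add: scaleC_complex_def)
    qed simp
    also have "\<dots> = c * L x"
      unfolding L_def directional_deriv_def by (rule deriv_cmult[OF D_diff])
    finally show "L (c *\<^sub>C x) = c *\<^sub>C L x" by (simp add: scaleC_complex_def)
  qed
  define t where "t = \<tau> / 2"
  have t: "t > 0" "cball 0 t \<subseteq> B" "ball 0 t \<subseteq> B" using \<tau>(1) by (auto simp: t_def B_def)
  have cauchy: "cmod (deriv g 0) \<le> K / t"
    if g: "g holomorphic_on B" and K: "\<And>\<zeta>. \<zeta> \<in> B \<Longrightarrow> cmod (g \<zeta>) \<le> K" for g K
  proof -
    have "cmod ((deriv ^^ 1) g 0) \<le> fact 1 * K / t ^ 1"
    proof (rule Cauchy_inequality)
      show "g holomorphic_on ball 0 t" using g t holomorphic_on_subset by blast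
      show "continuous_on (cball 0 t) g"
        using g t holomorphic_on_subset holomorphic_on_imp_continuous_on by blast
      show "cmod (g x) \<le> K" if "cmod (0 - x) = t" for x
        using that t by (intro K) (auto simp: subset_iff)
    qed (fact t)
    then show ?thesis by simp
  qed
  define K where "K = 2 * M / \<rho>\<^sup>2 / t"
  have K: "K \<ge> 0" using M t by (simp add: K_def)
  have rem: "cmod (D v (p + h) - D v p - L h) \<le> K * (norm h)\<^sup>2" if h: "norm h < \<rho> / 2" for h
  proof -
    let ?R = "\<lambda>\<zeta>. f (p + \<zeta> *\<^sub>C v + h) - f (p + \<zeta> *\<^sub>C v) - D h (p + \<zeta> *\<^sub>C v)"
    have hols: "(\<lambda>\<zeta>. f (p + \<zeta> *\<^sub>C v + h)) holomorphic_on B" "(\<lambda>\<zeta>. f (p + \<zeta> *\<^sub>C v)) holomorphic_on B"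
      using slice_hol[OF h] slice_hol[of 0] \<rho>(1) by simp_all
    have diffs: "(\<lambda>\<zeta>. f (p + \<zeta> *\<^sub>C v + h)) field_differentiable at 0"
      "(\<lambda>\<zeta>. f (p + \<zeta> *\<^sub>C v)) field_differentiable at 0"
      using hols B holomorphic_on_imp_differentiable_at by blast+
    have "deriv ?R 0 = deriv (\<lambda>\<zeta>. f (p + \<zeta> *\<^sub>C v + h)) 0 - deriv (\<lambda>\<zeta>. f (p + \<zeta> *\<^sub>C v)) 0
        - deriv (\<lambda>\<zeta>. D h (p + \<zeta> *\<^sub>C v)) 0"
      by (simp add: diffs D_diff field_differentiable_diff deriv_diff)
    also have "\<dots> = D v (p + h) - D v p - L h"
      unfolding D_def L_def directional_deriv_def by (simp add: algebra_simps)
    finally have eq: "deriv ?R 0 = D v (p + h) - D v p - L h" .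
    have "cmod (deriv ?R 0) \<le> (2 * M / \<rho>\<^sup>2 * (norm h)\<^sup>2) / t"
    proof (rule cauchy)
      show "?R holomorphic_on B" by (intro holomorphic_intros hols D_hol)
      show "cmod (?R \<zeta>) \<le> 2 * M / \<rho>\<^sup>2 * (norm h)\<^sup>2" if "\<zeta> \<in> B" for \<zeta>
        unfolding D_def
      proof (rule taylor)
        show "p + \<zeta> *\<^sub>C v \<in> ball p \<rho>" using inB[OF that] half by blast
        show "norm h < \<rho>" using h \<rho>(1) by simp
      qed
    qed
    then show ?thesis unfolding eq K_def by simp
  qed
  have L_bound: "cmod (L h) \<le> norm h * (2 * M / \<rho> / t)" for h
  proof (cases "h = 0")
    case True
    then show ?thesis using clinear_simps(3)[OF L_lin] by simp
  next
    case False
    have "cmod (L h) \<le> (2 * M * norm h / \<rho>) / t"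
      unfolding L_def directional_deriv_def
    proof (rule cauchy[OF D_hol])
      fix \<zeta> assume "\<zeta> \<in> B"
      with inB half have z: "p + \<zeta> *\<^sub>C v \<in> ball p \<rho>" by blast
      have "cmod (D h (p + \<zeta> *\<^sub>C v)) \<le> M / (\<rho> / norm h)"
        unfolding D_def
        by (rule directional_deriv_bound[OF holB bound z, of "2 * \<rho>"])
          (use \<rho>(1) False in auto)
      also have "\<dots> \<le> 2 * M * norm h / \<rho>" using M \<rho>(1) by (simp add: field_simps)
      finally show "cmod (D h (p + \<zeta> *\<^sub>C v)) \<le> 2 * M * norm h / \<rho>" .
    qed
    then show ?thesis by (simp add: field_simps)
  qed
  have "bounded_linear L"
    by (rule bounded_linear_intro[OF _ _ L_bound])
      (simp_all add: clinear_simps[OF L_lin] scaleR_scaleC scaleR_conv_of_real scaleC_complex_def)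
  moreover have "\<exists>d>0. \<forall>y. norm (y - p) < d \<longrightarrow> cmod (D v y - D v p - L (y - p)) \<le> e * norm (y - p)"
    if e: "e > 0" for e
  proof (intro exI[of _ "min (\<rho> / 2) (e / (K + 1))"] conjI allI impI)
    show "min (\<rho> / 2) (e / (K + 1)) > 0" using \<rho>(1) e K by simp
    fix y assume y: "norm (y - p) < min (\<rho> / 2) (e / (K + 1))"
    then have "cmod (D v y - D v p - L (y - p)) \<le> K * (norm (y - p))\<^sup>2"
      using rem[of "y - p"] by simp
    also have "\<dots> \<le> ((K + 1) * norm (y - p)) * norm (y - p)"
      by (simp add: power2_eq_square algebra_simps)
    also have "\<dots> \<le> e * norm (y - p)"
      using y K by (intro mult_right_mono) (auto simp: field_simps)
    finally show "cmod (D v y - D v p - L (y - p)) \<le> e * norm (y - p)" .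
  qed
  ultimately have "(D v has_derivative L) (at p)"
    unfolding has_derivative_at_alt by blast
  then show "\<exists>L. (directional_deriv v f has_derivative L) (at p) \<and> clinear L"
    using L_lin unfolding D_def by blast
qed


subsection \<open>The algebra of meromorphic functions\<close>

text \<open>Locally a meromorphic function is a quotient \<open>g / h\<close> of holomorphic functions where \<open>h\<close>
  does not vanish identically near any point. Its values at the zeros of \<open>h\<close> are irrelevant,
  whence the identification of functions that agree on a dense open set.\<close>

definition meromorphic :: "('v::complex_normed_vector \<Rightarrow> complex) \<Rightarrow> bool"
  where "meromorphic f \<longleftrightarrow> (\<forall>p. \<exists>V g h. open V \<and> p \<in> V \<and> holomorphic g V \<and> holomorphic h V \<and>
    V \<subseteq> closure {x \<in> V. h x \<noteq> 0} \<and> (\<forall>x\<in>V. h x \<noteq> 0 \<longrightarrow> f x = g x / h x))"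

definition generically_equal :: "('v::complex_normed_vector \<Rightarrow> complex) \<Rightarrow> ('v \<Rightarrow> complex) \<Rightarrow> bool"
  where "generically_equal f g \<longleftrightarrow> (\<exists>D. open D \<and> closure D = UNIV \<and> (\<forall>x\<in>D. f x = g x))"

definition mero_equiv :: "('v::complex_normed_vector \<Rightarrow> complex) \<Rightarrow> ('v \<Rightarrow> complex) \<Rightarrow> bool"
  where "mero_equiv f g \<longleftrightarrow> meromorphic f \<and> meromorphic g \<and> generically_equal f g"

lemma open_nonzero:
  assumes "holomorphic h V" "open V"
  shows "open {x \<in> V. h x \<noteq> 0}"
proof -
  have "continuous_on V h"
    using holomorphic_continuous[OF assms(1)] by (simp add: continuous_at_imp_continuous_on)
  then have "open (V \<inter> h -` (- {0}))"
    by (intro continuous_open_preimage assms(2)) auto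
  moreover have "V \<inter> h -` (- {0}) = {x \<in> V. h x \<noteq> 0}" by auto
  ultimately show ?thesis by simp
qed

lemma meromorphic_pairE:
  fixes f\<^sub>1 f\<^sub>2 :: "'v::complex_normed_vector \<Rightarrow> complex"
  assumes "meromorphic f\<^sub>1" "meromorphic f\<^sub>2"
  obtains V g\<^sub>1 g\<^sub>2 h where "open V" "p \<in> V" "holomorphic g\<^sub>1 V" "holomorphic g\<^sub>2 V" "holomorphic h V"
    "V \<subseteq> closure {x \<in> V. h x \<noteq> 0}" "\<And>x. x \<in> V \<Longrightarrow> h x \<noteq> 0 \<Longrightarrow> f\<^sub>1 x = g\<^sub>1 x / h x"
    "\<And>x. x \<in> V \<Longrightarrow> h x \<noteq> 0 \<Longrightarrow> f\<^sub>2 x = g\<^sub>2 x / h x"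
proof -
  obtain V g h where "open V \<and> p \<in> V \<and> holomorphic g V \<and> holomorphic h V \<and>
      V \<subseteq> closure {x \<in> V. h x \<noteq> 0} \<and> (\<forall>x\<in>V. h x \<noteq> 0 \<longrightarrow> f\<^sub>1 x = g x / h x)"
    using spec[OF assms(1)[unfolded meromorphic_def], of p] by auto
  then have 1: "open V" "p \<in> V" "holomorphic g V" "holomorphic h V"
      "V \<subseteq> closure {x \<in> V. h x \<noteq> 0}" "\<And>x. x \<in> V \<Longrightarrow> h x \<noteq> 0 \<Longrightarrow> f\<^sub>1 x = g x / h x"
    by simp_all
  obtain W k l where "open W \<and> p \<in> W \<and> holomorphic k W \<and> holomorphic l W \<and>
      W \<subseteq> closure {x \<in> W. l x \<noteq> 0} \<and> (\<forall>x\<in>W. l x \<noteq> 0 \<longrightarrow> f\<^sub>2 x = k x / l x)"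
    using spec[OF assms(2)[unfolded meromorphic_def], of p] by auto
  then have 2: "open W" "p \<in> W" "holomorphic k W" "holomorphic l W"
      "W \<subseteq> closure {x \<in> W. l x \<noteq> 0}" "\<And>x. x \<in> W \<Longrightarrow> l x \<noteq> 0 \<Longrightarrow> f\<^sub>2 x = k x / l x"
    by simp_all
  let ?U = "V \<inter> W"
  let ?A = "{x \<in> V. h x \<noteq> 0}" and ?B = "{x \<in> W. l x \<noteq> 0}"
  have A: "open ?A" by (rule open_nonzero[OF 1(4,1)])
  have U: "open ?U" using 1(1) 2(1) by blast
  have "closure (?U \<inter> ?A) = closure ?U"
    by (rule closure_open_Int_superset[OF U]) (use 1(5) in blast)
  moreover have "closure ((?U \<inter> ?A) \<inter> ?B) = closure (?U \<inter> ?A)"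
    by (rule closure_open_Int_superset) (use U A 2(5) in \<open>blast+\<close>)
  moreover have "(?U \<inter> ?A) \<inter> ?B = {x \<in> ?U. h x * l x \<noteq> 0}" by auto
  ultimately have dense: "?U \<subseteq> closure {x \<in> ?U. h x * l x \<noteq> 0}"
    using closure_subset[of ?U] by simp
  have hol: "holomorphic g ?U" "holomorphic h ?U" "holomorphic k ?U" "holomorphic l ?U"
    by (rule holomorphic_subset[OF 1(3)] holomorphic_subset[OF 1(4)]
        holomorphic_subset[OF 2(3)] holomorphic_subset[OF 2(4)], blast)+
  show thesis
  proof (rule that)
    show "holomorphic (\<lambda>x. g x * l x) ?U" "holomorphic (\<lambda>x. k x * h x) ?U"
      "holomorphic (\<lambda>x. h x * l x) ?U"
      by (intro holomorphic_mult hol)+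
    show "f\<^sub>1 x = (g x * l x) / (h x * l x)" if "x \<in> ?U" "h x * l x \<noteq> 0" for x
      using that 1(6)[of x] by simp
    show "f\<^sub>2 x = (k x * h x) / (h x * l x)" if "x \<in> ?U" "h x * l x \<noteq> 0" for x
      using that 2(6)[of x] by simp
  qed (use U 1(2) 2(2) dense in auto)
qed

lemma meromorphicI:
  assumes "\<And>p. \<exists>V g h. open V \<and> p \<in> V \<and> holomorphic g V \<and> holomorphic h V \<and>
    V \<subseteq> closure {x \<in> V. h x \<noteq> 0} \<and> (\<forall>x\<in>V. h x \<noteq> 0 \<longrightarrow> f x = g x / h x)"
  shows "meromorphic f"
  using assms unfolding meromorphic_def by blast

lemma holomorphic_imp_meromorphic: "holomorphic f UNIV \<Longrightarrow> meromorphic f"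
  by (rule meromorphicI, rule exI[of _ UNIV], rule exI[of _ f], rule exI[of _ "\<lambda>_. 1"])
    (simp add: holomorphic_const)

lemma meromorphic_const: "meromorphic (\<lambda>_. c)"
  by (rule holomorphic_imp_meromorphic[OF holomorphic_const])

lemma meromorphic_add:
  assumes "meromorphic f" "meromorphic g" shows "meromorphic (\<lambda>x. f x + g x)"
proof (rule meromorphicI)
  fix p
  show "\<exists>V k h. open V \<and> p \<in> V \<and> holomorphic k V \<and> holomorphic h V \<and>
    V \<subseteq> closure {x \<in> V. h x \<noteq> 0} \<and> (\<forall>x\<in>V. h x \<noteq> 0 \<longrightarrow> f x + g x = k x / h x)"
  proof (rule meromorphic_pairE[OF assms, of p])
    fix V g\<^sub>1 g\<^sub>2 h
    assume V: "open V" "p \<in> V" "holomorphic g\<^sub>1 V" "holomorphic g\<^sub>2 V" "holomorphic h V"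
      "V \<subseteq> closure {x \<in> V. h x \<noteq> 0}" "\<And>x. x \<in> V \<Longrightarrow> h x \<noteq> 0 \<Longrightarrow> f x = g\<^sub>1 x / h x"
      "\<And>x. x \<in> V \<Longrightarrow> h x \<noteq> 0 \<Longrightarrow> g x = g\<^sub>2 x / h x"
    show ?thesis
      by (rule exI[of _ V], rule exI[of _ "\<lambda>x. g\<^sub>1 x + g\<^sub>2 x"], rule exI[of _ h])
        (simp add: V holomorphic_add add_divide_distrib)
  qed
qed

lemma meromorphic_mult:
  assumes "meromorphic f" "meromorphic g" shows "meromorphic (\<lambda>x. f x * g x)"
proof (rule meromorphicI)
  fix p
  show "\<exists>V k h. open V \<and> p \<in> V \<and> holomorphic k V \<and> holomorphic h V \<and>
    V \<subseteq> closure {x \<in> V. h x \<noteq> 0} \<and> (\<forall>x\<in>V. h x \<noteq> 0 \<longrightarrow> f x * g x = k x / h x)"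
  proof (rule meromorphic_pairE[OF assms, of p])
    fix V g\<^sub>1 g\<^sub>2 h
    assume V: "open V" "p \<in> V" "holomorphic g\<^sub>1 V" "holomorphic g\<^sub>2 V" "holomorphic h V"
      "V \<subseteq> closure {x \<in> V. h x \<noteq> 0}" "\<And>x. x \<in> V \<Longrightarrow> h x \<noteq> 0 \<Longrightarrow> f x = g\<^sub>1 x / h x"
      "\<And>x. x \<in> V \<Longrightarrow> h x \<noteq> 0 \<Longrightarrow> g x = g\<^sub>2 x / h x"
    show ?thesis
      by (rule exI[of _ V], rule exI[of _ "\<lambda>x. g\<^sub>1 x * g\<^sub>2 x"], rule exI[of _ "\<lambda>x. h x * h x"])
        (simp add: V holomorphic_mult)
  qed
qed

lemma meromorphic_uminus: "meromorphic f \<Longrightarrow> meromorphic (\<lambda>x. - f x)"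
  using meromorphic_mult[OF meromorphic_const[of "-1"]] by simp

lemma meromorphic_diff: "meromorphic f \<Longrightarrow> meromorphic g \<Longrightarrow> meromorphic (\<lambda>x. f x - g x)"
  using meromorphic_add[OF _ meromorphic_uminus, of f g] by simp

lemmas meromorphic_intros = meromorphic_const meromorphic_add meromorphic_mult
  meromorphic_uminus meromorphic_diff

lemma eventually_slice:
  fixes v x :: "'v::complex_normed_vector"
  assumes "open S" "x \<in> S"
  shows "\<forall>\<^sub>F \<zeta> in nhds 0. x + \<zeta> *\<^sub>C v \<in> S"
proof -
  have "isCont (\<lambda>\<zeta>. x + \<zeta> *\<^sub>C v) 0"
    by (rule continuous_add[OF continuous_const linear_continuous_at[OF bounded_linear_scaleC_left]])
  then have "((\<lambda>\<zeta>. x + \<zeta> *\<^sub>C v) \<longlongrightarrow> x) (at 0)"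
    by (simp add: isCont_def)
  then have "\<forall>\<^sub>F \<zeta> in at 0. x + \<zeta> *\<^sub>C v \<in> S"
    using assms by (rule topological_tendstoD)
  then show ?thesis
    using assms(2) by (simp add: eventually_nhds_conv_at)
qed

lemma directional_deriv_cong:
  assumes "open S" "x \<in> S" "\<And>y. y \<in> S \<Longrightarrow> f y = g y"
  shows "directional_deriv v f x = directional_deriv v g x"
  unfolding directional_deriv_def
  by (intro deriv_cong_ev eventually_mono[OF eventually_slice[OF assms(1,2), of v]])
    (simp_all add: assms(3))

lemma directional_deriv_quotient:
  assumes g: "holomorphic g V" and h: "holomorphic h V" and V: "open V"
    and x: "x \<in> V" "h x \<noteq> 0" and f: "\<And>y. y \<in> V \<Longrightarrow> h y \<noteq> 0 \<Longrightarrow> f y = g y / h y"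
  shows "directional_deriv v f x =
    (directional_deriv v g x * h x - g x * directional_deriv v h x) / (h x * h x)" (is ?eq)
    and "((\<lambda>\<zeta>. f (x + \<zeta> *\<^sub>C v)) has_field_derivative directional_deriv v f x) (at 0)" (is ?der)
proof -
  have "((\<lambda>\<zeta>. g (x + \<zeta> *\<^sub>C v)) has_field_derivative directional_deriv v g x) (at 0)"
    and "((\<lambda>\<zeta>. h (x + \<zeta> *\<^sub>C v)) has_field_derivative directional_deriv v h x) (at 0)"
    using holomorphic_slice_deriv[OF g, of x 0 v] holomorphic_slice_deriv[OF h, of x 0 v] x by simp_all
  from DERIV_divide[OF this] x
  have q: "((\<lambda>\<zeta>. g (x + \<zeta> *\<^sub>C v) / h (x + \<zeta> *\<^sub>C v)) has_field_derivative
      (directional_deriv v g x * h x - g x * directional_deriv v h x) / (h x * h x)) (at 0)"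
    by simp
  have ev: "\<forall>\<^sub>F \<zeta> in nhds 0. f (x + \<zeta> *\<^sub>C v) = g (x + \<zeta> *\<^sub>C v) / h (x + \<zeta> *\<^sub>C v)"
    by (rule eventually_mono[OF eventually_slice[OF open_nonzero[OF h V], of x v]]) (use x f in auto)
  have "((\<lambda>\<zeta>. f (x + \<zeta> *\<^sub>C v)) has_field_derivative
      (directional_deriv v g x * h x - g x * directional_deriv v h x) / (h x * h x)) (at 0)"
    using q DERIV_cong_ev[OF refl ev refl] by blast
  then show ?der and ?eq
    unfolding directional_deriv_def[of v f] by (simp_all add: DERIV_imp_deriv)
qed

lemma meromorphic_directional_deriv:
  assumes "meromorphic f"
  shows "meromorphic (directional_deriv v f)"
proof (rule meromorphicI)
  fix p
  show "\<exists>V k h. open V \<and> p \<in> V \<and> holomorphic k V \<and> holomorphic h V \<and>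
    V \<subseteq> closure {x \<in> V. h x \<noteq> 0} \<and> (\<forall>x\<in>V. h x \<noteq> 0 \<longrightarrow> directional_deriv v f x = k x / h x)"
  proof (rule meromorphic_pairE[OF assms assms, of p])
    fix V g g\<^sub>2 h
    assume V: "open V" "p \<in> V" "holomorphic g V" "holomorphic g\<^sub>2 V" "holomorphic h V"
      "V \<subseteq> closure {x \<in> V. h x \<noteq> 0}" and f: "\<And>x. x \<in> V \<Longrightarrow> h x \<noteq> 0 \<Longrightarrow> f x = g x / h x"
    show ?thesis
    proof (rule exI[of _ V],
        rule exI[of _ "\<lambda>x. directional_deriv v g x * h x - g x * directional_deriv v h x"],
        rule exI[of _ "\<lambda>x. h x * h x"], intro conjI)
      show "holomorphic (\<lambda>x. directional_deriv v g x * h x - g x * directional_deriv v h x) V"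
        by (intro holomorphic_diff holomorphic_mult holomorphic_directional_deriv V)
      show "\<forall>x\<in>V. h x * h x \<noteq> 0 \<longrightarrow> directional_deriv v f x =
          (directional_deriv v g x * h x - g x * directional_deriv v h x) / (h x * h x)"
        by (intro ballI impI directional_deriv_quotient(1)[OF V(3) V(5) V(1)] f) auto
    qed (simp_all add: V holomorphic_mult)
  qed
qed

lemma generically_equal_refl: "generically_equal f f"
  unfolding generically_equal_def by (intro exI[of _ UNIV]) simp

lemma generically_equal_sym: "generically_equal f g \<Longrightarrow> generically_equal g f"
  unfolding generically_equal_def by metis

lemma generically_equal_combine:
  fixes f f' g g' :: "'v::complex_normed_vector \<Rightarrow> complex"
  assumes "generically_equal f f'" "generically_equal g g'"
  shows "\<exists>D. open D \<and> closure D = UNIV \<and> (\<forall>x\<in>D. f x = f' x \<and> g x = g' x)"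
proof -
  obtain D where D: "open D" "closure D = UNIV" "\<forall>x\<in>D. f x = f' x"
    using assms(1) unfolding generically_equal_def by blast
  obtain E where E: "open E" "closure E = UNIV" "\<forall>x\<in>E. g x = g' x"
    using assms(2) unfolding generically_equal_def by blast
  have "closure (D \<inter> E) = UNIV"
    using closure_open_Int_superset[OF D(1), of E] E(2) D(2) by simp
  then show ?thesis
    using D E by (intro exI[of _ "D \<inter> E"]) auto
qed

lemma generically_equal_trans:
  assumes "generically_equal f g" "generically_equal g h"
  shows "generically_equal f h"
proof -
  obtain D where "open D" "closure D = UNIV" "\<forall>x\<in>D. f x = g x \<and> g x = h x"
    using generically_equal_combine[OF assms] by auto
  then show ?thesis unfolding generically_equal_def by (intro exI[of _ D]) simp
qed

lemma part_equivp_mero_equiv: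
  "part_equivp (mero_equiv :: ('v::complex_normed_vector \<Rightarrow> complex) \<Rightarrow> _)"
proof (rule part_equivpI)
  show "\<exists>f :: 'v \<Rightarrow> complex. mero_equiv f f"
    unfolding mero_equiv_def using meromorphic_const generically_equal_refl by blast
  show "symp (mero_equiv :: ('v \<Rightarrow> complex) \<Rightarrow> _)"
    unfolding symp_def mero_equiv_def using generically_equal_sym by blast
  show "transp (mero_equiv :: ('v \<Rightarrow> complex) \<Rightarrow> _)"
    unfolding transp_def mero_equiv_def using generically_equal_trans by blast
qed

quotient_type (overloaded) 'v mero = "'v::complex_normed_vector \<Rightarrow> complex" / partial: mero_equiv
  by (rule part_equivp_mero_equiv)

lemma mero_equivI: "meromorphic f \<Longrightarrow> f = g \<Longrightarrow> mero_equiv f g"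
  by (simp add: mero_equiv_def generically_equal_refl)

lemma mero_equiv_binop:
  fixes f f' g g' :: "'v::complex_normed_vector \<Rightarrow> complex"
  assumes f: "mero_equiv f f'" and g: "mero_equiv g g'"
    and op: "\<And>f g :: 'v \<Rightarrow> complex. meromorphic f \<Longrightarrow> meromorphic g \<Longrightarrow> meromorphic (\<lambda>x. F (f x) (g x))"
  shows "mero_equiv (\<lambda>x. F (f x) (g x)) (\<lambda>x. F (f' x) (g' x))"
proof -
  from f g have "generically_equal f f'" "generically_equal g g'"
    unfolding mero_equiv_def by blast+
  from generically_equal_combine[OF this]
  have "generically_equal (\<lambda>x. F (f x) (g x)) (\<lambda>x. F (f' x) (g' x))"
    unfolding generically_equal_def by (elim exE) (rule exI, auto)
  then show ?thesis
    using f g op[of f g] op[of f' g'] unfolding mero_equiv_def by simp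
qed

instantiation mero :: (complex_normed_vector) complex_algebra_1
begin

lift_definition zero_mero :: "'a mero" is "\<lambda>_. 0"
  by (rule mero_equivI[OF meromorphic_const refl])

lift_definition one_mero :: "'a mero" is "\<lambda>_. 1"
  by (rule mero_equivI[OF meromorphic_const refl])

lift_definition plus_mero :: "'a mero \<Rightarrow> 'a mero \<Rightarrow> 'a mero" is "\<lambda>f g x. f x + g x"
  by (rule mero_equiv_binop[OF _ _ meromorphic_add])

lift_definition minus_mero :: "'a mero \<Rightarrow> 'a mero \<Rightarrow> 'a mero" is "\<lambda>f g x. f x - g x"
  by (rule mero_equiv_binop[OF _ _ meromorphic_diff])

lift_definition times_mero :: "'a mero \<Rightarrow> 'a mero \<Rightarrow> 'a mero" is "\<lambda>f g x. f x * g x"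
  by (rule mero_equiv_binop[OF _ _ meromorphic_mult])

lift_definition uminus_mero :: "'a mero \<Rightarrow> 'a mero" is "\<lambda>f x. - f x"
  by (rule mero_equiv_binop[where F = "\<lambda>a _. - a", OF _ _ meromorphic_uminus])

lift_definition scaleC_mero :: "complex \<Rightarrow> 'a mero \<Rightarrow> 'a mero" is "\<lambda>c f x. c * f x"
  by (rule mero_equiv_binop[where F = "\<lambda>a _. _ * a", OF _ _ meromorphic_mult[OF meromorphic_const]])

instance
proof
  fix f g h :: "'a mero" and c d :: complex
  show "f + g + h = f + (g + h)" "f + g = g + f" "0 + f = f" "- f + f = 0" "f - g = f + - g"
    "f * g * h = f * (g * h)" "(f + g) * h = f * h + g * h" "f * (g + h) = f * g + f * h"
    "1 * f = f" "f * 1 = f"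
    "c *\<^sub>C (f + g) = c *\<^sub>C f + c *\<^sub>C g" "(c + d) *\<^sub>C f = c *\<^sub>C f + d *\<^sub>C f"
    "c *\<^sub>C d *\<^sub>C f = (c * d) *\<^sub>C f" "1 *\<^sub>C f = f"
    "(c *\<^sub>C f) * g = c *\<^sub>C (f * g)" "f * (c *\<^sub>C g) = c *\<^sub>C (f * g)"
    by (transfer, rule mero_equivI, unfold mero_equiv_def,
        (intro meromorphic_intros; elim conjE; assumption)[1],
        rule ext, simp add: algebra_simps)+
qed

end

instance mero :: (complex_normed_vector) comm_ring_1
proof
  fix f g h :: "'a mero"
  show "f * g = g * f"
    by (transfer, rule mero_equivI, unfold mero_equiv_def,
        (intro meromorphic_intros; elim conjE; assumption)[1], rule ext, rule mult.commute)
  show "1 * f = f" by simp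
  show "(f + g) * h = f * h + g * h" by (rule distrib_right)
  show "(0 :: 'a mero) \<noteq> 1"
    by transfer (auto simp: mero_equiv_def generically_equal_def)
qed

lift_definition mero_deriv :: "'v::complex_normed_vector \<Rightarrow> 'v mero \<Rightarrow> 'v mero" is directional_deriv
proof -
  fix v :: 'v and f g :: "'v \<Rightarrow> complex"
  assume fg: "mero_equiv f g"
  then obtain D where D: "open D" "closure D = UNIV" "\<forall>x\<in>D. f x = g x"
    unfolding mero_equiv_def generically_equal_def by blast
  then have "\<forall>x\<in>D. directional_deriv v f x = directional_deriv v g x"
    using directional_deriv_cong[OF D(1)] by blast
  then show "mero_equiv (directional_deriv v f) (directional_deriv v g)"
    using fg D meromorphic_directional_deriv unfolding mero_equiv_def generically_equal_def by blast
qed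

lemma generically_equal_localI:
  assumes "\<And>p. \<exists>V A. p \<in> V \<and> open A \<and> V \<subseteq> closure A \<and> (\<forall>x\<in>A. f x = g x)"
  shows "generically_equal f g"
proof -
  define D where "D = \<Union>{A. open A \<and> (\<forall>x\<in>A. f x = g x)}"
  have "p \<in> closure D" for p
  proof -
    obtain V A where A: "p \<in> V" "open A" "V \<subseteq> closure A" "\<forall>x\<in>A. f x = g x"
      using assms[of p] by auto
    then have "closure A \<subseteq> closure D" by (intro closure_mono) (auto simp: D_def)
    then show ?thesis using A by blast
  qed
  then have "closure D = UNIV" by blast
  then show ?thesis
    unfolding generically_equal_def by (intro exI[of _ D]) (auto simp: D_def)
qed

lemma clinear_mero_deriv: "clinear (mero_deriv v)"
proof (rule clinearI)
  fix f g :: "'a mero" and c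
  show "mero_deriv v (f + g) = mero_deriv v f + mero_deriv v g"
  proof (transfer, goal_cases)
    case (1 v f g)
    then have fg: "meromorphic f" "meromorphic g" by (auto simp: mero_equiv_def)
    have "generically_equal (directional_deriv v (\<lambda>x. f x + g x))
        (\<lambda>x. directional_deriv v f x + directional_deriv v g x)"
    proof (rule generically_equal_localI)
      fix p
      show "\<exists>V A. p \<in> V \<and> open A \<and> V \<subseteq> closure A \<and>
        (\<forall>x\<in>A. directional_deriv v (\<lambda>x. f x + g x) x = directional_deriv v f x + directional_deriv v g x)"
      proof (rule meromorphic_pairE[OF fg, of p])
        fix V g\<^sub>1 g\<^sub>2 h
        assume V: "open V" "p \<in> V" "holomorphic g\<^sub>1 V" "holomorphic g\<^sub>2 V" "holomorphic h V"
          "V \<subseteq> closure {x \<in> V. h x \<noteq> 0}" "\<And>x. x \<in> V \<Longrightarrow> h x \<noteq> 0 \<Longrightarrow> f x = g\<^sub>1 x / h x"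
          "\<And>x. x \<in> V \<Longrightarrow> h x \<noteq> 0 \<Longrightarrow> g x = g\<^sub>2 x / h x"
        have "directional_deriv v (\<lambda>x. f x + g x) x = directional_deriv v f x + directional_deriv v g x"
          if x: "x \<in> V" "h x \<noteq> 0" for x
          unfolding directional_deriv_def[of v "\<lambda>x. f x + g x"]
          by (intro DERIV_imp_deriv DERIV_add directional_deriv_quotient(2)[OF V(3,5,1) x V(7)]
              directional_deriv_quotient(2)[OF V(4,5,1) x V(8)])
        then show ?thesis
          by (intro exI[of _ V] exI[of _ "{x \<in> V. h x \<noteq> 0}"])
            (simp add: V open_nonzero[OF V(5,1)])
      qed
    qed
    then show ?case
      unfolding mero_equiv_def
      by (intro conjI meromorphic_add meromorphic_directional_deriv fg)
  qed
  show "mero_deriv v (c *\<^sub>C f) = c *\<^sub>C mero_deriv v f"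
  proof (transfer, goal_cases)
    case (1 v c f)
    then have f: "meromorphic f" by (auto simp: mero_equiv_def)
    have "generically_equal (directional_deriv v (\<lambda>x. c * f x)) (\<lambda>x. c * directional_deriv v f x)"
    proof (rule generically_equal_localI)
      fix p
      show "\<exists>V A. p \<in> V \<and> open A \<and> V \<subseteq> closure A \<and>
        (\<forall>x\<in>A. directional_deriv v (\<lambda>x. c * f x) x = c * directional_deriv v f x)"
      proof (rule meromorphic_pairE[OF f f, of p])
        fix V g\<^sub>1 g\<^sub>2 h
        assume V: "open V" "p \<in> V" "holomorphic g\<^sub>1 V" "holomorphic g\<^sub>2 V" "holomorphic h V"
          "V \<subseteq> closure {x \<in> V. h x \<noteq> 0}" "\<And>x. x \<in> V \<Longrightarrow> h x \<noteq> 0 \<Longrightarrow> f x = g\<^sub>1 x / h x"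
        have "directional_deriv v (\<lambda>x. c * f x) x = c * directional_deriv v f x"
          if x: "x \<in> V" "h x \<noteq> 0" for x
          unfolding directional_deriv_def[of v "\<lambda>x. c * f x"]
          by (intro DERIV_imp_deriv DERIV_cmult directional_deriv_quotient(2)[OF V(3,5,1) x V(7)])
        then show ?thesis
          by (intro exI[of _ V] exI[of _ "{x \<in> V. h x \<noteq> 0}"])
            (simp add: V open_nonzero[OF V(5,1)])
      qed
    qed
    then show ?case
      unfolding mero_equiv_def
      by (intro conjI meromorphic_mult meromorphic_const meromorphic_directional_deriv f)
  qed
qed


section \<open>The dual of a finite dimensional subspace\<close>

definition linear_functionals :: "'u::complex_vector set \<Rightarrow> ('u \<Rightarrow> complex) set"
  where "linear_functionals A = {\<phi> \<in> extensional A.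
    (\<forall>x\<in>A. \<forall>y\<in>A. \<phi> (x + y) = \<phi> x + \<phi> y) \<and> (\<forall>c. \<forall>x\<in>A. \<phi> (c *\<^sub>C x) = c * \<phi> x)}"

text \<open>The dual of a subspace \<open>A\<close>, being a set depending on \<open>A\<close>, is not itself a type. It is
  represented by a type \<open>'v\<close> together with a linear isomorphism \<open>ev\<close> from \<open>'v\<close> onto the space of
  linear functionals on \<open>A\<close>. As \<open>'v\<close> is then finite dimensional, its topology, and hence
  the notion of a meromorphic function on it, does not depend on the norm.\<close>

definition represents_dual :: "('v::complex_vector \<Rightarrow> 'u::complex_vector \<Rightarrow> complex) \<Rightarrow> 'u set \<Rightarrow> bool"
  where "represents_dual ev A \<longleftrightarrow>
    bij_betw ev UNIV (linear_functionals A) \<and> (\<forall>x\<in>A. clinear (\<lambda>l. ev l x))"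

definition dual_bases :: "('v \<Rightarrow> 'u::complex_vector \<Rightarrow> complex) \<Rightarrow> 'u set \<Rightarrow>
    nat \<Rightarrow> (nat \<Rightarrow> 'u) \<Rightarrow> (nat \<Rightarrow> 'v) \<Rightarrow> bool"
  where "dual_bases ev A d x l \<longleftrightarrow>
    inj_on x {..<d} \<and> complex_vector.independent (x ` {..<d}) \<and>
    complex_vector.span (x ` {..<d}) = A \<and>
    (\<forall>j<d. \<forall>k<d. ev (l j) (x k) = (if j = k then 1 else 0))"


section \<open>Dynamical Yang--Baxter and reflection expressions\<close>

text \<open>A meromorphic function with values in \<open>'b\<close> is an element of the tensor product
  \<open>'v mero \<otimes> 'b\<close>; \<open>1 \<otimes> b\<close> is the constant function \<open>b\<close>.\<close>

definition pointwise :: "('b::complex_vector \<Rightarrow> 'c::complex_vector) \<Rightarrow>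
    ('v::complex_normed_vector mero \<otimes> 'b) \<Rightarrow> ('v mero \<otimes> 'c)"
  where "pointwise \<phi> = tensor_map (\<lambda>f. f) \<phi>"

definition deriv_along :: "'v::complex_normed_vector \<Rightarrow>
    ('v mero \<otimes> 'b::complex_vector) \<Rightarrow> ('v mero \<otimes> 'b)"
  where "deriv_along v = tensor_map (mero_deriv v) (\<lambda>b. b)"

text \<open>The maps \<open>z \<mapsto> z\<^sub>i\<close>, \<open>z \<mapsto> z\<^sub>i\<^sub>j\<close> into the second and third tensor power; the latter is
  bracketed to the right. The last digit of each name is the target power.\<close>

definition pos1_2 :: "'u::complex_algebra_1 \<Rightarrow> ('u \<otimes> 'u)" where "pos1_2 a = a \<otimes> 1"
definition pos2_2 :: "'u::complex_algebra_1 \<Rightarrow> ('u \<otimes> 'u)" where "pos2_2 a = 1 \<otimes> a"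

definition pos1_3 :: "'u::complex_algebra_1 \<Rightarrow> ('u \<otimes> 'u \<otimes> 'u)" where "pos1_3 a = a \<otimes> 1 \<otimes> 1"
definition pos2_3 :: "'u::complex_algebra_1 \<Rightarrow> ('u \<otimes> 'u \<otimes> 'u)" where "pos2_3 a = 1 \<otimes> a \<otimes> 1"
definition pos3_3 :: "'u::complex_algebra_1 \<Rightarrow> ('u \<otimes> 'u \<otimes> 'u)" where "pos3_3 a = 1 \<otimes> 1 \<otimes> a"

definition pos21_2 :: "('u::complex_algebra_1 \<otimes> 'u) \<Rightarrow> ('u \<otimes> 'u)"
  where "pos21_2 = tensor_lift (\<lambda>a b. b \<otimes> a)"

definition pos12_3 :: "('u::complex_algebra_1 \<otimes> 'u) \<Rightarrow> ('u \<otimes> 'u \<otimes> 'u)"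
  where "pos12_3 = tensor_lift (\<lambda>a b. a \<otimes> b \<otimes> 1)"
definition pos13_3 :: "('u::complex_algebra_1 \<otimes> 'u) \<Rightarrow> ('u \<otimes> 'u \<otimes> 'u)"
  where "pos13_3 = tensor_lift (\<lambda>a b. a \<otimes> 1 \<otimes> b)"
definition pos23_3 :: "('u::complex_algebra_1 \<otimes> 'u) \<Rightarrow> ('u \<otimes> 'u \<otimes> 'u)"
  where "pos23_3 = tensor_lift (\<lambda>a b. 1 \<otimes> a \<otimes> b)"

lemma tensor_position_simps [simp]:
  "pos21_2 (a \<otimes> b) = b \<otimes> a" "pos12_3 (a \<otimes> b) = a \<otimes> b \<otimes> 1"
  "pos13_3 (a \<otimes> b) = a \<otimes> 1 \<otimes> b" "pos23_3 (a \<otimes> b) = 1 \<otimes> a \<otimes> b"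
  unfolding pos21_2_def pos12_3_def pos13_3_def pos23_3_def
  by (rule tensor_lift_pure, unfold cbilinear_def, intro conjI allI clinearI,
      simp_all add: pure_tensor_add_left pure_tensor_add_right
        pure_tensor_scaleC_left pure_tensor_scaleC_right)+

definition mult_map :: "('u::complex_algebra_1 \<otimes> 'u) \<Rightarrow> 'u"
  where "mult_map = tensor_lift (*)"

lemma mult_map_pure [simp]: "mult_map (a \<otimes> b) = a * b"
  unfolding mult_map_def
  by (rule tensor_lift_pure, unfold cbilinear_def, intro conjI allI clinearI)
    (simp_all add: distrib_left distrib_right mult_scaleC_left mult_scaleC_right)

text \<open>\<open>E d x l pos\<close> is the operator \<open>E\<^sub>i\<close>, where \<open>pos\<close> is the embedding in position \<open>i\<close>.\<close>

definition E :: "nat \<Rightarrow> (nat \<Rightarrow> 'u) \<Rightarrow> (nat \<Rightarrow> 'v) \<Rightarrow> ('u \<Rightarrow> 'b) \<Rightarrow>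
    ('v::complex_normed_vector mero \<otimes> 'b::complex_algebra_1) \<Rightarrow> ('v mero \<otimes> 'b)"
  where "E d x l pos F = (\<Sum>k<d. (1 \<otimes> pos (x k)) * deriv_along (l k) F)"

definition YB :: "nat \<Rightarrow> (nat \<Rightarrow> 'u::complex_algebra_1) \<Rightarrow> (nat \<Rightarrow> 'v::complex_normed_vector) \<Rightarrow>
    ('v mero \<otimes> 'u \<otimes> 'u) \<Rightarrow> ('v mero \<otimes> 'u \<otimes> 'u \<otimes> 'u)"
  where "YB d x l r =
    (let r12 = pointwise pos12_3 r; r13 = pointwise pos13_3 r; r23 = pointwise pos23_3 r in
      commutator r12 r13 + commutator r12 r23 + commutator r13 r23
      + E d x l pos1_3 r23 - E d x l pos2_3 r13 + E d x l pos3_3 r12)"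

definition CR :: "nat \<Rightarrow> (nat \<Rightarrow> 'u::complex_algebra_1) \<Rightarrow> (nat \<Rightarrow> 'v::complex_normed_vector) \<Rightarrow>
    ('v mero \<otimes> 'u \<otimes> 'u) \<Rightarrow> ('v mero \<otimes> 'u \<otimes> 'u) \<Rightarrow> ('v mero \<otimes> 'u) \<Rightarrow> ('v mero \<otimes> 'u \<otimes> 'u)"
  where "CR d x l rp rm \<kappa> =
    (let \<kappa>1 = pointwise pos1_2 \<kappa>; \<kappa>2 = pointwise pos2_2 \<kappa> in
      commutator (\<kappa>1 + rm) (\<kappa>2 + rp)
      + E d x l pos2_2 (rm + \<kappa>1) - E d x l pos1_2 (rp + \<kappa>2))"

definition twist :: "('u::complex_algebra_1 \<Rightarrow> 'u) \<Rightarrow>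
    ('v::complex_normed_vector mero \<otimes> 'u \<otimes> 'u) \<Rightarrow> ('v mero \<otimes> 'u \<otimes> 'u)"
  where "twist \<theta> r = pointwise (tensor_map \<theta> (\<lambda>u. u)) r"

definition r_plus :: "('u::complex_algebra_1 \<Rightarrow> 'u) \<Rightarrow>
    ('v::complex_normed_vector mero \<otimes> 'u \<otimes> 'u) \<Rightarrow> ('v mero \<otimes> 'u \<otimes> 'u)"
  where "r_plus \<theta> r = (1/2) *\<^sub>C (twist \<theta> r + r)"

definition r_minus :: "('u::complex_algebra_1 \<Rightarrow> 'u) \<Rightarrow>
    ('v::complex_normed_vector mero \<otimes> 'u \<otimes> 'u) \<Rightarrow> ('v mero \<otimes> 'u \<otimes> 'u)"
  where "r_minus \<theta> r = (1/2) *\<^sub>C (twist \<theta> r - r)"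

definition kappa_core :: "('u::complex_algebra_1 \<Rightarrow> 'u) \<Rightarrow>
    ('v::complex_normed_vector mero \<otimes> 'u \<otimes> 'u) \<Rightarrow> ('v mero \<otimes> 'u)"
  where "kappa_core \<theta> r = (1/2) *\<^sub>C pointwise mult_map (twist \<theta> r)"

end

(* Multiplying tensor components of YB(r) = 0 in four ways, namely applying the linear maps
     u (x) v (x) w |-> theta(u) v (x) w,   u (x) v (x) w |-> v theta(u) (x) w,
     u (x) v (x) w |-> v (x) theta(u) w,   u (x) v (x) w |-> v (x) w theta(u),
   produces the products of kappa_1, kappa_2, r and the twist of r that occur in CR, together with
   some mixed terms. The latter cancel in the sum of the four identities, because r is fixed by
   a (x) b |-> theta(b) (x) theta(a). By a-invariance, the derivative terms of the sum are those
   of 4 CR. *)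

theory Submission
  imports Defs
begin

section \<open>Linear maps on tensor products\<close>

lemma clinear_id: "clinear (\<lambda>a. a)"
  by (rule clinearI) simp_all

lemma clinear_sum:
  assumes "clinear f"
  shows "f (sum g S) = (\<Sum>a\<in>S. f (g a))"
proof -
  interpret Vector_Spaces.linear scaleC scaleC f by (fact assms)
  show ?thesis by (rule sum)
qed

text \<open>Sums of pure tensors already exhaust the triple tensor product, because scalars are
  absorbed into one factor.\<close>

lemma tensor3_induct [case_names pure add]:
  fixes t :: "'a::complex_vector \<otimes> 'b::complex_vector \<otimes> 'c::complex_vector"
  assumes pure: "\<And>a b c. P (a \<otimes> b \<otimes> c)" and add: "\<And>s t. P s \<Longrightarrow> P t \<Longrightarrow> P (s + t)"
  shows "P t"
proof (induction t rule: tensor_induct)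
  case (pure a s)
  show ?case
    by (induction s rule: tensor_induct) (simp_all add: pure_tensor_add_right assms)
qed (rule add)

lemma clinear_pos21_2: "clinear pos21_2"
  and clinear_pos12_3: "clinear pos12_3"
  and clinear_pos13_3: "clinear pos13_3"
  and clinear_pos23_3: "clinear pos23_3"
  and clinear_mult_map: "clinear mult_map"
  unfolding pos21_2_def pos12_3_def pos13_3_def pos23_3_def mult_map_def
  by (rule clinear_tensor_lift, unfold cbilinear_def, intro conjI allI clinearI,
      simp_all add: pure_tensor_add_left pure_tensor_add_right distrib_left distrib_right
        pure_tensor_scaleC_left pure_tensor_scaleC_right mult_scaleC_left mult_scaleC_right)+

lemma clinear_pos1_2: "clinear pos1_2"
  and clinear_pos2_2: "clinear pos2_2"
  unfolding pos1_2_def pos2_2_def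
  by (rule clinearI, simp_all add: pure_tensor_add_left pure_tensor_add_right
        pure_tensor_scaleC_left pure_tensor_scaleC_right)+

lemma clinear_pointwise: "clinear \<phi> \<Longrightarrow> clinear (pointwise \<phi>)"
  unfolding pointwise_def by (intro clinear_tensor_map clinear_id)

lemma pointwise_pure: "clinear \<phi> \<Longrightarrow> pointwise \<phi> (f \<otimes> b) = f \<otimes> \<phi> b"
  by (simp add: pointwise_def clinear_id)

lemma pointwise_pos_pure:
  "pointwise pos1_2 (f \<otimes> a) = f \<otimes> a \<otimes> 1"
  "pointwise pos2_2 (f \<otimes> a) = f \<otimes> 1 \<otimes> a"
  by (simp_all only: pointwise_pure clinear_pos1_2 clinear_pos2_2) (simp_all add: pos1_2_def pos2_2_def)

lemma clinear_deriv_along: "clinear (deriv_along v)"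
  unfolding deriv_along_def by (intro clinear_tensor_map clinear_id clinear_mero_deriv)

lemma deriv_along_pure: "deriv_along v (f \<otimes> b) = mero_deriv v f \<otimes> b"
  by (simp add: deriv_along_def clinear_id clinear_mero_deriv)

lemma clinear_E: "clinear (E d x l pos)"
  by (rule clinearI)
    (simp_all add: E_def clinear_simps[OF clinear_deriv_along] distrib_left sum.distrib
      mult_scaleC_right complex_vector.scale_sum_right)

lemma minus_pure_tensor: "(- a) \<otimes> b = - (a \<otimes> b)" "a \<otimes> (- b) = - (a \<otimes> b)"
  using pure_tensor_scaleC_left[of "-1" a b] pure_tensor_scaleC_right[of a "-1" b] by simp_all

text \<open>The product is bracketed to the right, so the lift runs over the first factor and the
  inner map acts on the remaining pair: \<open>u \<otimes> v \<otimes> w\<close> goes to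
  \<open>\<beta> u v \<otimes> w\<close> here, and to \<open>v \<otimes> \<beta> u w\<close> under
  \<open>merge_right\<close>.\<close>

definition merge_left :: "('a::complex_vector \<Rightarrow> 'b::complex_vector \<Rightarrow> 'd::complex_vector)
    \<Rightarrow> ('a \<otimes> 'b \<otimes> 'c::complex_vector) \<Rightarrow> ('d \<otimes> 'c)"
  where "merge_left \<beta> = tensor_lift (\<lambda>u. tensor_map (\<beta> u) (\<lambda>w. w))"

definition merge_right :: "('a::complex_vector \<Rightarrow> 'c::complex_vector \<Rightarrow> 'd::complex_vector)
    \<Rightarrow> ('a \<otimes> 'b::complex_vector \<otimes> 'c) \<Rightarrow> ('b \<otimes> 'd)"
  where "merge_right \<beta> = tensor_lift (\<lambda>u. tensor_map (\<lambda>v. v) (\<beta> u))"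

lemma
  fixes \<beta> :: "'a::complex_vector \<Rightarrow> 'b::complex_vector \<Rightarrow> 'd::complex_vector"
    and w :: "'c::complex_vector"
  assumes \<beta>: "cbilinear \<beta>"
  shows clinear_merge_left: "clinear (merge_left \<beta> :: ('a \<otimes> 'b \<otimes> 'c) \<Rightarrow> _)"
    and merge_left_pure: "merge_left \<beta> (u \<otimes> v \<otimes> w) = \<beta> u v \<otimes> w"
    and clinear_merge_right: "clinear (merge_right \<beta> :: ('a \<otimes> 'c \<otimes> 'b) \<Rightarrow> _)"
    and merge_right_pure: "merge_right \<beta> (u \<otimes> w \<otimes> v) = w \<otimes> \<beta> u v"
proof -
  have lin: "clinear (\<beta> a)" "clinear (\<lambda>a. \<beta> a b)" for a b
    using \<beta> unfolding cbilinear_def by auto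
  note lmaps = clinear_tensor_map[OF lin(1) clinear_id] clinear_tensor_map[OF clinear_id lin(1)]
  note eqs = clinear_simps(1,2)[OF lmaps(1)] clinear_simps(1,2)[OF lmaps(2)]
    clinear_simps(1,2)[OF lin(1)] clinear_simps(1,2)[OF lin(2)]
  have "tensor_map (\<beta> (a + a')) (\<lambda>w. w) t = tensor_map (\<beta> a) (\<lambda>w. w) t + tensor_map (\<beta> a') (\<lambda>w. w) t"
    "tensor_map (\<beta> (c *\<^sub>C a)) (\<lambda>w. w) t = c *\<^sub>C tensor_map (\<beta> a) (\<lambda>w. w) t"
    "tensor_map (\<lambda>w. w) (\<beta> (a + a')) t' = tensor_map (\<lambda>w. w) (\<beta> a) t' + tensor_map (\<lambda>w. w) (\<beta> a') t'"
    "tensor_map (\<lambda>w. w) (\<beta> (c *\<^sub>C a)) t' = c *\<^sub>C tensor_map (\<lambda>w. w) (\<beta> a) t'"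
    for a a' c and t :: "'b \<otimes> 'c" and t' :: "'c \<otimes> 'b"
    \<comment> \<open>Each equation involves only one of \<open>t\<close> and \<open>t'\<close>;
      inducting on both settles all four uniformly.\<close>
    by (induction t rule: tensor_induct; induction t' rule: tensor_induct;
        simp add: eqs lin clinear_id pure_tensor_add_left pure_tensor_add_right
        pure_tensor_scaleC_left pure_tensor_scaleC_right scaleC_add_right)+
  then have "cbilinear (\<lambda>u. tensor_map (\<beta> u) (\<lambda>w::'c. w))"
    "cbilinear (\<lambda>u. tensor_map (\<lambda>w::'c. w) (\<beta> u))"
    unfolding cbilinear_def by (auto intro!: clinearI simp: eqs)
  from clinear_tensor_lift[OF this(1)] tensor_lift_pure[OF this(1)]
    clinear_tensor_lift[OF this(2)] tensor_lift_pure[OF this(2)]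
  show "clinear (merge_left \<beta> :: ('a \<otimes> 'b \<otimes> 'c) \<Rightarrow> _)" "merge_left \<beta> (u \<otimes> v \<otimes> w) = \<beta> u v \<otimes> w"
    "clinear (merge_right \<beta> :: ('a \<otimes> 'c \<otimes> 'b) \<Rightarrow> _)" "merge_right \<beta> (u \<otimes> w \<otimes> v) = w \<otimes> \<beta> u v"
    unfolding merge_left_def merge_right_def by (simp_all add: lin clinear_id)
qed

section \<open>Merging components of the Yang--Baxter expression\<close>

locale involutive_automorphism =
  fixes \<theta> :: "'u::complex_algebra_1 \<Rightarrow> 'u"
  assumes automorphism: "algebra_automorphism \<theta>" and involutive: "\<theta> (\<theta> u) = u"
begin

section \<open>The twist and twisted symmetry\<close>

lemma clinear: "clinear \<theta>"
  and mult: "\<theta> (a * b) = \<theta> a * \<theta> b"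
  and one: "\<theta> 1 = 1"
  using automorphism unfolding algebra_automorphism_def by auto

lemma cbilinear_theta_mult: "cbilinear (\<lambda>u v. \<theta> u * v)"
  and cbilinear_mult_theta: "cbilinear (\<lambda>u v. v * \<theta> u)"
  unfolding cbilinear_def
  by (intro conjI allI clinearI;
      simp add: clinear_simps[OF clinear] distrib_left distrib_right mult_scaleC_left mult_scaleC_right)+

lemma clinear_twist: "clinear (twist \<theta>)"
  unfolding twist_def by (intro clinear_pointwise clinear_tensor_map clinear clinear_id)

lemma twist_pure: "twist \<theta> (f \<otimes> a \<otimes> b) = f \<otimes> \<theta> a \<otimes> b"
  by (simp add: twist_def pointwise_pure clinear_tensor_map clinear clinear_id)

lemma twist_twist: "twist \<theta> (twist \<theta> s) = s"
  by (induction s rule: tensor3_induct)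
    (simp_all add: twist_pure involutive clinear_simps(1)[OF clinear_twist])

text \<open>On pure tensors this is \<open>a \<otimes> b\<close> to
  \<open>\<theta> b \<otimes> \<theta> a\<close>. As \<open>twist \<theta>\<close> is an involution,
  the fixed points of \<open>flip\<close> are exactly the twisted symmetric elements.\<close>

definition flip :: "('v::complex_normed_vector mero \<otimes> 'u \<otimes> 'u) \<Rightarrow> ('v mero \<otimes> 'u \<otimes> 'u)"
  where "flip s = twist \<theta> (pointwise pos21_2 (twist \<theta> s))"

lemma flip_pure: "flip (f \<otimes> a \<otimes> b) = f \<otimes> \<theta> b \<otimes> \<theta> a"
  by (simp add: flip_def twist_pure pointwise_pure clinear_pos21_2)

lemma flip_add: "flip (s + t) = flip s + flip t"
  unfolding flip_def
  by (simp add: clinear_simps(1)[OF clinear_twist] clinear_simps(1)[OF clinear_pointwise[OF clinear_pos21_2]])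

lemma flip_eqI: "pointwise pos21_2 (twist \<theta> s) = twist \<theta> s \<Longrightarrow> flip s = s"
  by (simp add: flip_def twist_twist)

text \<open>\<open>K r\<close> is twice \<open>kappa_core \<theta> r\<close>; the factor is restored
  in \<open>CR_quadruple\<close>.\<close>

abbreviation "K s \<equiv> pointwise mult_map (twist \<theta> s)"
abbreviation "K1 s \<equiv> pointwise pos1_2 (K s)"
abbreviation "K2 s \<equiv> pointwise pos2_2 (K s)"
abbreviation "P12 \<equiv> pointwise pos12_3"
abbreviation "P13 \<equiv> pointwise pos13_3"
abbreviation "P23 \<equiv> pointwise pos23_3"
text \<open>The four merging maps: \<open>L\<close> and \<open>L'\<close> merge the first slot into
  the second, \<open>R\<close> and \<open>R'\<close> merge it into the third. The leg carrying
  \<open>\<theta>\<close> stands on the left without a prime and on the right with one.\<close>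

abbreviation "L \<equiv> pointwise (merge_left (\<lambda>u v. \<theta> u * v))"
abbreviation "L' \<equiv> pointwise (merge_left (\<lambda>u v. v * \<theta> u))"
abbreviation "R \<equiv> pointwise (merge_right (\<lambda>u v. \<theta> u * v))"
abbreviation "R' \<equiv> pointwise (merge_right (\<lambda>u v. v * \<theta> u))"

lemmas clinears =
  clinear_pos12_3 clinear_pos13_3 clinear_pos23_3 clinear_mult_map clinear_pos1_2 clinear_pos2_2
  clinear_merge_left[OF cbilinear_theta_mult] clinear_merge_left[OF cbilinear_mult_theta]
  clinear_merge_right[OF cbilinear_theta_mult] clinear_merge_right[OF cbilinear_mult_theta]

lemmas adds = clinears[THEN clinear_pointwise, THEN clinear_simps(1)]
  clinear_simps(1)[OF clinear_twist] clinear_simps(1)[OF clinear_deriv_along]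
  flip_add distrib_left distrib_right

text \<open>Entries 5 and 6 of \<open>clinears\<close> are left out because
  \<open>pointwise_pos_pure\<close> evaluates \<open>pos1_2\<close> and \<open>pos2_2\<close> to
  explicit tensors; the entries from 7 on are the merging maps.\<close>

lemmas pures = pointwise_pos_pure clinears(1-4,7-)[THEN pointwise_pure] twist_pure flip_pure deriv_along_pure pure_tensor_mult
  merge_left_pure[OF cbilinear_theta_mult] merge_left_pure[OF cbilinear_mult_theta]
  merge_right_pure[OF cbilinear_theta_mult] merge_right_pure[OF cbilinear_mult_theta]
  involutive mult one mult.assoc

text \<open>Biadditivity suffices to reduce an identity to pure tensors, where \<open>pures\<close>
  computes both sides.\<close>

lemma bilinear_eqI:
  fixes F G :: "('v::complex_normed_vector mero \<otimes> 'u \<otimes> 'u) \<Rightarrow> ('v mero \<otimes> 'u \<otimes> 'u) \<Rightarrow> 'c::complex_vector"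
  assumes "\<And>s s' t. F (s + s') t = F s t + F s' t" "\<And>s t t'. F s (t + t') = F s t + F s t'"
    "\<And>s s' t. G (s + s') t = G s t + G s' t" "\<And>s t t'. G s (t + t') = G s t + G s t'"
    "\<And>f a b g a' b'. F (f \<otimes> a \<otimes> b) (g \<otimes> a' \<otimes> b') = G (f \<otimes> a \<otimes> b) (g \<otimes> a' \<otimes> b')"
  shows "F s t = G s t"
proof (induction s rule: tensor3_induct)
  case (pure f a b)
  show ?case by (induction t rule: tensor3_induct) (simp_all add: assms)
qed (simp add: assms)

section \<open>Quadratic terms under the four merging maps\<close>

lemma K1_K2_commute:
  "K1 s * K2 t = K2 t * K1 s"
  \<comment> \<open>Elements in different slots commute; \<open>mult.commute\<close> is needed only
    for the meromorphic coefficients.\<close>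
  by (rule bilinear_eqI[where s = s and t = t], simp_all add: adds pures mult.commute)

text \<open>For each commutator of \<open>YB\<close>, these are the orders of the factors whose
  image under \<open>L\<close> splits into a product in the double tensor power.\<close>

lemma L_products:
  "L (P13 t * P12 s) = twist \<theta> t * K1 s"
  "L (P12 s * P23 t) = K1 s * t"
  "L (P13 s * P23 t) = twist \<theta> s * t"
  by (rule bilinear_eqI[where s = s and t = t], simp_all add: adds pures mult.commute)+

text \<open>The reversed multiplication yields \<open>b * \<theta> a\<close> in place of
  \<open>\<theta> a * b\<close>, which is \<open>K\<close> of the flipped tensor.\<close>

lemma L'_products:
  "L' (P12 s * P13 t) = K1 (flip s) * twist \<theta> t"
  "L' (P23 t * P12 s) = t * K1 (flip s)"
  "L' (P23 t * P13 s) = t * twist \<theta> s"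
  by (rule bilinear_eqI[where s = s and t = t], simp_all add: adds pures mult.commute)+

text \<open>The first leg of \<open>P12 s\<close> passes to the last slot, leaving
  \<open>b \<otimes> \<theta> a\<close>; this is the twist of \<open>flip s\<close>.\<close>

lemma R_products:
  "R (P12 s * P13 t) = twist \<theta> (flip s) * K2 t"
  "R (P12 s * P23 t) = twist \<theta> (flip s) * t"
  "R (P13 s * P23 t) = K2 s * t"
  by (rule bilinear_eqI[where s = s and t = t], simp_all add: adds pures mult.commute)+

lemma R'_products:
  "R' (P13 t * P12 s) = K2 (flip t) * twist \<theta> (flip s)"
  "R' (P23 t * P12 s) = t * twist \<theta> (flip s)"
  "R' (P23 t * P13 s) = t * K2 (flip s)"
  by (rule bilinear_eqI[where s = s and t = t], simp_all add: adds pures mult.commute)+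

text \<open>In the remaining orders the two legs of one factor stand on opposite sides of the other
  factor, within one slot or across two. Exchanging these legs by \<open>flip\<close> gives the same
  tensor from another merging map. The two sides carry opposite signs in \<open>YB\<close>, so for
  \<open>flip r = r\<close> they cancel in six pairs.\<close>

lemma mixed_products:
  "L (P12 s * P13 t) = L' (P13 t * P12 (flip s))"
  "L (P23 t * P12 s) = L' (P12 (flip s) * P23 t)"
  "R (P13 t * P12 s) = R' (P12 s * P13 (flip t))"
  "R (P23 t * P13 s) = R' (P13 (flip s) * P23 t)"
  "L (P23 t * P13 s) = R' (P12 (flip s) * P23 t)"
  "L' (P13 s * P23 t) = R (P23 t * P12 (flip s))"
  by (rule bilinear_eqI[where s = s and t = t], simp_all add: adds pures mult.commute)+

section \<open>Derivative terms and invariance\<close>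

lemma merge_derivative_terms:
  fixes s :: "'v::complex_normed_vector mero \<otimes> 'u \<otimes> 'u"
  assumes y: "\<theta> y = - y"
  defines "y1 \<equiv> 1 \<otimes> y \<otimes> 1" and "y2 \<equiv> 1 \<otimes> 1 \<otimes> y"
  shows "L ((1 \<otimes> y \<otimes> 1 \<otimes> 1) * deriv_along v (P23 s)) = - (y1 * deriv_along v s)"
    "L ((1 \<otimes> 1 \<otimes> y \<otimes> 1) * deriv_along v (P13 s)) = deriv_along v (twist \<theta> s) * y1"
    "L ((1 \<otimes> 1 \<otimes> 1 \<otimes> y) * deriv_along v (P12 s)) = y2 * deriv_along v (K1 s)"
    "L' ((1 \<otimes> y \<otimes> 1 \<otimes> 1) * deriv_along v (P23 s)) = - (deriv_along v s * y1)"
    "L' ((1 \<otimes> 1 \<otimes> y \<otimes> 1) * deriv_along v (P13 s)) = y1 * deriv_along v (twist \<theta> s)"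
    "L' ((1 \<otimes> 1 \<otimes> 1 \<otimes> y) * deriv_along v (P12 s)) = y2 * deriv_along v (K1 (flip s))"
    "R ((1 \<otimes> y \<otimes> 1 \<otimes> 1) * deriv_along v (P23 s)) = - (y2 * deriv_along v s)"
    "R ((1 \<otimes> 1 \<otimes> y \<otimes> 1) * deriv_along v (P13 s)) = y1 * deriv_along v (K2 s)"
    "R ((1 \<otimes> 1 \<otimes> 1 \<otimes> y) * deriv_along v (P12 s)) = deriv_along v (twist \<theta> (flip s)) * y2"
    "R' ((1 \<otimes> y \<otimes> 1 \<otimes> 1) * deriv_along v (P23 s)) = - (deriv_along v s * y2)"
    "R' ((1 \<otimes> 1 \<otimes> y \<otimes> 1) * deriv_along v (P13 s)) = y1 * deriv_along v (K2 (flip s))"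
    "R' ((1 \<otimes> 1 \<otimes> 1 \<otimes> y) * deriv_along v (P12 s)) = y2 * deriv_along v (twist \<theta> (flip s))"
  \<comment> \<open>Only \<open>y\<close> in the first slot meets \<open>\<theta>\<close>, whence
    the minus signs. Whether \<open>y\<close> ends up left or right of the merged leg decides the
    side of the multiplication.\<close>
  unfolding y1_def y2_def
  by (induction s rule: tensor3_induct, simp_all add: adds pures y minus_pure_tensor)+

text \<open>Differentiation commutes with multiplication by constant tensors, so invariance passes
  to derivatives. Twisting replaces \<open>y1\<close> by \<open>- y1\<close> because
  \<open>\<theta> y = - y\<close>, which turns the sum into a difference.\<close>

lemma
  fixes s :: "'v::complex_normed_vector mero \<otimes> 'u \<otimes> 'u"
  assumes "\<theta> y = - y" and inv: "commutator (1 \<otimes> (y \<otimes> 1 + 1 \<otimes> y)) s = 0"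
  defines "y1 \<equiv> 1 \<otimes> y \<otimes> 1" and "y2 \<equiv> 1 \<otimes> 1 \<otimes> y"
  shows deriv_invariant: "deriv_along v s * y1 + deriv_along v s * y2 = y1 * deriv_along v s + y2 * deriv_along v s"
    and deriv_twist_invariant: "deriv_along v (twist \<theta> s) * y2 - deriv_along v (twist \<theta> s) * y1
      = y2 * deriv_along v (twist \<theta> s) - y1 * deriv_along v (twist \<theta> s)"
proof -
  have D: "deriv_along v (z * s) = z * deriv_along v s" "deriv_along v (s * z) = deriv_along v s * z"
    if "z = 1 \<otimes> y \<otimes> 1 \<or> z = 1 \<otimes> 1 \<otimes> y" for z :: "'v mero \<otimes> 'u \<otimes> 'u" and s
    using that by (induction s rule: tensor3_induct; auto simp: adds pures)+
  have T: "twist \<theta> (y1 * s) = - (y1 * twist \<theta> s)" "twist \<theta> (s * y1) = - (twist \<theta> s * y1)"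
    "twist \<theta> (y2 * s) = y2 * twist \<theta> s" "twist \<theta> (s * y2) = twist \<theta> s * y2" for s
    unfolding y1_def y2_def
    by (induction s rule: tensor3_induct, simp_all add: adds pures assms(1) minus_pure_tensor)+
  have eq: "s * y1 + s * y2 = y1 * s + y2 * s"
    using inv unfolding commutator_def y1_def y2_def
    by (simp add: pure_tensor_add_right algebra_simps)
  from arg_cong[OF this, of "deriv_along v"]
  show "deriv_along v s * y1 + deriv_along v s * y2 = y1 * deriv_along v s + y2 * deriv_along v s"
    by (simp add: adds D y1_def y2_def)
  from arg_cong[OF eq, of "\<lambda>s. deriv_along v (twist \<theta> s)"]
  show "deriv_along v (twist \<theta> s) * y2 - deriv_along v (twist \<theta> s) * y1
      = y2 * deriv_along v (twist \<theta> s) - y1 * deriv_along v (twist \<theta> s)"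
    by (simp add: adds T clinear_simps[OF clinear_deriv_along])
      (simp add: D y1_def y2_def)
qed

section \<open>From the four identities to the reflection expression\<close>

lemma CR_quadruple:
  fixes r :: "'v::complex_normed_vector mero \<otimes> 'u \<otimes> 'u" and d :: nat
    and x :: "nat \<Rightarrow> 'u" and l :: "nat \<Rightarrow> 'v"
  defines "E1 \<equiv> E d x l pos1_2" and "E2 \<equiv> E d x l pos2_2" and "S \<equiv> twist \<theta> r"
  shows "4 *\<^sub>C CR d x l (r_plus \<theta> r) (r_minus \<theta> r) (kappa_core \<theta> r) =
    commutator (K1 r + S - r) (K2 r + S + r) + (E2 (S - r + K1 r) + E2 (S - r + K1 r))
    - (E1 (S + r + K2 r) + E1 (S + r + K2 r))"
proof -
  \<comment> \<open>All arguments carry a factor 1/2: the bracket is quadratic in them and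
    \<open>E\<close> is linear, so clearing denominators by 4 leaves every derivative term
    twice.\<close>
  have quarter: "commutator ((1/2) *\<^sub>C z) ((1/2) *\<^sub>C w) = (1/2) *\<^sub>C (1/2) *\<^sub>C commutator z w"
    for z w :: "'v mero \<otimes> 'u \<otimes> 'u"
    by (simp add: commutator_def mult_scaleC_left mult_scaleC_right complex_vector.scale_right_diff_distrib)
  have args: "pointwise pos1_2 (kappa_core \<theta> r) + r_minus \<theta> r = (1/2) *\<^sub>C (K1 r + S - r)"
    "pointwise pos2_2 (kappa_core \<theta> r) + r_plus \<theta> r = (1/2) *\<^sub>C (K2 r + S + r)"
    "r_minus \<theta> r + pointwise pos1_2 (kappa_core \<theta> r) = (1/2) *\<^sub>C (S - r + K1 r)"
    "r_plus \<theta> r + pointwise pos2_2 (kappa_core \<theta> r) = (1/2) *\<^sub>C (S + r + K2 r)"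
    unfolding kappa_core_def r_minus_def r_plus_def S_def
    by (simp_all add: clinear_simps[OF clinear_pointwise[OF clinear_pos1_2]]
        clinear_simps[OF clinear_pointwise[OF clinear_pos2_2]]
        complex_vector.scale_right_diff_distrib complex_vector.scale_right_distrib algebra_simps)
  have "CR d x l (r_plus \<theta> r) (r_minus \<theta> r) (kappa_core \<theta> r) =
    (1/2) *\<^sub>C (1/2) *\<^sub>C commutator (K1 r + S - r) (K2 r + S + r)
    + (1/2) *\<^sub>C E2 (S - r + K1 r) - (1/2) *\<^sub>C E1 (S + r + K2 r)"
    unfolding CR_def Let_def args quarter E1_def E2_def by (simp only: clinear_simps(2)[OF clinear_E])
  then show ?thesis
    by (simp add: scaleC_scaleC complex_vector.scale_right_diff_distrib complex_vector.scale_right_distrib)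
      (simp add: scaleC_add_left[of 1 1, simplified] scaleC_one)
qed

lemma CR_kappa_core:
  fixes r :: "'v::complex_normed_vector mero \<otimes> 'u \<otimes> 'u" and d :: nat
    and x :: "nat \<Rightarrow> 'u" and l :: "nat \<Rightarrow> 'v"
  assumes x: "\<And>k. k < d \<Longrightarrow> \<theta> (x k) = - x k"
    and sym: "flip r = r"
    and inv: "\<And>k. k < d \<Longrightarrow> commutator (1 \<otimes> (x k \<otimes> 1 + 1 \<otimes> x k)) r = 0"
    and YB: "YB d x l r = 0"
  shows "CR d x l (r_plus \<theta> r) (r_minus \<theta> r) (kappa_core \<theta> r) = 0"
proof -
  \<comment> \<open>The counterpart of \<open>E\<close> with \<open>x k\<close> multiplied from the
    right, as it arises from merging.\<close>
  define F where "F pos s = (\<Sum>k<d. deriv_along (l k) s * (1 \<otimes> pos (x k)))"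
    for pos :: "'u \<Rightarrow> 'u \<otimes> 'u" and s :: "'v mero \<otimes> 'u \<otimes> 'u"
  define S where "S = twist \<theta> r"
  let ?E1 = "E d x l pos1_2" and ?E2 = "E d x l pos2_2"
  note linears = clinears(7-)[THEN clinear_pointwise]
  have eqs: "L (E d x l pos1_3 (P23 r)) = - ?E1 r"
    "L (E d x l pos2_3 (P13 r)) = F pos1_2 S"
    "L (E d x l pos3_3 (P12 r)) = ?E2 (K1 r)"
    "L' (E d x l pos1_3 (P23 r)) = - F pos1_2 r"
    "L' (E d x l pos2_3 (P13 r)) = ?E1 S"
    "L' (E d x l pos3_3 (P12 r)) = ?E2 (K1 r)"
    "R (E d x l pos1_3 (P23 r)) = - ?E2 r"
    "R (E d x l pos2_3 (P13 r)) = ?E1 (K2 r)"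
    "R (E d x l pos3_3 (P12 r)) = F pos2_2 S"
    "R' (E d x l pos1_3 (P23 r)) = - F pos2_2 r"
    "R' (E d x l pos2_3 (P13 r)) = ?E1 (K2 r)"
    "R' (E d x l pos3_3 (P12 r)) = ?E2 S"
    unfolding E_def F_def S_def linears[THEN clinear_sum] sum_negf[symmetric]
    by (rule sum.cong[OF refl],
        simp add: pos1_2_def pos2_2_def pos1_3_def pos2_3_def pos3_3_def merge_derivative_terms x sym)+
  have "F pos1_2 r + F pos2_2 r = ?E1 r + ?E2 r" "F pos2_2 S - F pos1_2 S = ?E2 S - ?E1 S"
    unfolding E_def F_def S_def sum.distrib[symmetric] sum_subtractf[symmetric]
    by (rule sum.cong[OF refl],
        simp add: pos1_2_def pos2_2_def deriv_invariant[OF x inv] deriv_twist_invariant[OF x inv])+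
  \<comment> \<open>Solved for \<open>pos2_2\<close>: after substitution the \<open>F pos1_2\<close>
    terms cancel in the sum of the four identities.\<close>
  then have F: "F pos2_2 r = ?E1 r + ?E2 r - F pos1_2 r" "F pos2_2 S = ?E2 S - ?E1 S + F pos1_2 S"
    by (simp_all add: algebra_simps)
  note YB' = YB[unfolded YB_def Let_def commutator_def]
  note expand = linears[THEN clinear_simps(1)] linears[THEN clinear_simps(3)] linears[THEN clinear_simps(5)]
    eqs L_products[of r r] L'_products[of r r, unfolded sym] R_products[of r r, unfolded sym]
    R'_products[of r r, unfolded sym] mixed_products[of r r, unfolded sym] S_def[symmetric]
  \<comment> \<open>All four images of \<open>YB\<close> are added with sign plus; the commutators
    themselves supply the opposite signs of the mixed products.\<close>
  note sum4 = arg_cong2[where f = "(+)", OF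
    arg_cong2[where f = "(+)", OF arg_cong[OF YB', of L] arg_cong[OF YB', of L']]
    arg_cong2[where f = "(+)", OF arg_cong[OF YB', of R] arg_cong[OF YB', of R']]]
  have "4 *\<^sub>C CR d x l (r_plus \<theta> r) (r_minus \<theta> r) (kappa_core \<theta> r) = 0"
    unfolding CR_quadruple S_def[symmetric]
    \<comment> \<open>Of the 24 products the 12 mixed ones cancel, and the other 12 form the bracket
      of \<open>K1 r + S - r\<close> with \<open>K2 r + S + r\<close>, where the bracket of
      \<open>K1 r\<close> and \<open>K2 r\<close> vanishes.\<close>
    by (rule trans[OF _ trans[OF sum4[unfolded expand]]])
      (simp_all add: F K1_K2_commute[of r r, folded S_def] commutator_def clinear_simps[OF clinear_E]
        algebra_simps)
  then show ?thesis by simp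
qed

end

theorem theorem5p6:
  fixes \<theta> :: "'u::complex_algebra_1 \<Rightarrow> 'u"
    and \<aa> :: "'u set"
    and ev :: "'v::complex_normed_vector \<Rightarrow> 'u \<Rightarrow> complex"
    and d :: nat and x :: "nat \<Rightarrow> 'u" and l :: "nat \<Rightarrow> 'v"
    and r :: "'v mero \<otimes> 'u \<otimes> 'u"
  assumes "algebra_automorphism \<theta>"
    and "\<forall>u. \<theta> (\<theta> u) = u"
    and "complex_vector.subspace \<aa>"
    and "\<exists>B. finite B \<and> complex_vector.span B = \<aa>"
    and "\<aa> \<subseteq> {u. \<theta> u = - u}"
    and "represents_dual ev \<aa>"
    and "dual_bases ev \<aa> d x l"
    and "pointwise pos21_2 (twist \<theta> r) = twist \<theta> r"
    and "\<forall>y\<in>\<aa>. commutator (1 \<otimes> (y \<otimes> 1 + 1 \<otimes> y)) r = 0"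
    and "YB d x l r = 0"
  shows "CR d x l (r_plus \<theta> r) (r_minus \<theta> r) (kappa_core \<theta> r) = 0"
proof -
  interpret involutive_automorphism \<theta>
    using assms(1,2) by unfold_locales auto
  have x: "x k \<in> \<aa>" if "k < d" for k
    using that assms(7) complex_vector.span_superset[of "x ` {..<d}"] unfolding dual_bases_def by fast
  show ?thesis
  proof (rule CR_kappa_core)
    show "\<theta> (x k) = - x k" if "k < d" for k
      using x[OF that] assms(5) by fast
    show "flip r = r"
      by (rule flip_eqI) (rule assms(8))
    show "commutator (1 \<otimes> (x k \<otimes> 1 + 1 \<otimes> x k)) r = 0" if "k < d" for k
      using x[OF that] assms(9) by blast
  qed (rule assms(10))
qed

end
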